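(* For every natural number $n$ there exists a finite collection $\mathcal{U}=\{U_0,\ldots,U_m\}$ of finite simplicial filtrations $U_i=(U_i^\alpha)_{\alpha\ge 0}$, all $U_i^\alpha$ being subcomplexes of one simplicial complex, such that $\mathcal{U}$ is a $1$-good cover filtration of $\mathcal{W}=(\bigcup_{i=0}^m U_i^\alpha)_{\alpha\ge 0}$ and $$\mathrm{d}_B\big(\mathrm{Dgm}_K(\mathrm{Nrv}\,\mathcal{U}),\mathrm{Dgm}_K(\mathcal{W})\big)=K+1\quad\text{for all integers } 0\le K\le n .$$
   Context: All homology is taken with coefficients in $\mathbb{Z}/2\mathbb{Z}$. A finite simplicial filtration is a family $(F^\alpha)_{\alpha\ge 0}$ of finite simplicial complexes, indexed by real $\alpha\ge 0$, with $F^\alpha\subseteq F^\beta$ whenever $\alpha\le\beta$. Write $[m]=\{0,\ldots,m\}$ and, for non-empty $v\subseteq[m]$, $U_v^\alpha=\bigcap_{i\in v}U_i^\alpha$. The nerve at scale $\alpha$ is the abstract simplicial complex $\mathrm{Nrv}\,\mathcal{U}^\alpha=\{\emptyset\ne\sigma\subseteq[m] : U_\sigma^\alpha\neq\emptyset\}$, and $\mathrm{Nrv}\,\mathcal{U}=(\mathrm{Nrv}\,\mathcal{U}^\alpha)_{\alpha\ge 0}$. For $\varepsilon\ge 0$, $\mathcal{U}$ is an $\varepsilon$-good cover filtration of $\mathcal{W}$ if for every non-empty $v\subseteq[m]$ and every $\alpha\ge 0$ the inclusion $U_v^\alpha\hookrightarrow U_v^{\alpha+\varepsilon}$ induces the zero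 map on reduced homology $\tilde H_k$ in every degree $k\ge 0$ (no condition when $U_v^\alpha=\emptyset$). For a filtration $\mathcal{F}$ with pointwise finite-dimensional homology, $\mathrm{Dgm}_K(\mathcal{F})$ is the persistence diagram of the persistence module $(H_K(F^\alpha))_{\alpha\ge 0}$ with maps induced by inclusions: the multiset of (birth, death) points together with all diagonal points with infinite multiplicity. The bottleneck distance is $\mathrm{d}_B(D,D')=\inf_{\phi}\sup_{p\in D}\|p-\phi(p)\|_\infty$ over all bijections $\phi:D\to D'$. *)

theory Defs
  imports
    "HOL-Analysis.Analysis"
    "HOL-Algebra.Product_Groups"
    "HOL-Library.Z2"
begin

section \<open>Finite simplicial filtrations\<close>

text \<open>A simplicial complex is the set of its non-empty simplices; a subcomplex is a complex that
  is a subset, so intersections and unions of subcomplexes are those of sets.\<close>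

definition abstract_complex :: "'v set set \<Rightarrow> bool" where
  "abstract_complex X \<longleftrightarrow>
     (\<forall>\<sigma>\<in>X. finite \<sigma> \<and> \<sigma> \<noteq> {} \<and> (\<forall>\<tau>. \<tau> \<subseteq> \<sigma> \<and> \<tau> \<noteq> {} \<longrightarrow> \<tau> \<in> X))"

text \<open>Only the values of a filtration at parameters \<open>\<alpha> \<ge> 0\<close> matter, here and below.\<close>

definition simplicial_filtration :: "(real \<Rightarrow> 'v set set) \<Rightarrow> bool" where
  "simplicial_filtration F \<longleftrightarrow>
     (\<forall>\<alpha>\<ge>0. abstract_complex (F \<alpha>) \<and> finite (F \<alpha>)) \<and>
     (\<forall>\<alpha> \<beta>. 0 \<le> \<alpha> \<and> \<alpha> \<le> \<beta> \<longrightarrow> F \<alpha> \<subseteq> F \<beta>)"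

section \<open>Simplicial homology over \<open>\<int>/2\<int>\<close>\<close>

definition chain_group :: "'v set set \<Rightarrow> nat \<Rightarrow> ('v set \<Rightarrow> bit) monoid" where
  "chain_group X k =
     \<lparr>carrier = {c. finite {\<sigma>. c \<sigma> \<noteq> 0} \<and> (\<forall>\<sigma>. c \<sigma> \<noteq> 0 \<longrightarrow> \<sigma> \<in> X \<and> card \<sigma> = Suc k)},
      monoid.mult = (\<lambda>c d \<sigma>. c \<sigma> + d \<sigma>), one = (\<lambda>\<sigma>. 0)\<rparr>"

text \<open>The coefficient of the boundary of \<open>c\<close> at \<open>\<tau>\<close> is the sum of the coefficients of \<open>c\<close> at the
  simplices having \<open>\<tau>\<close> as a facet. Excluding \<open>\<tau> = {}\<close> makes the boundary of a \<open>0\<close>-chain zero.\<close>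

definition boundary :: "('v set \<Rightarrow> bit) \<Rightarrow> 'v set \<Rightarrow> bit" where
  "boundary c = (\<lambda>\<tau>. if \<tau> = {} then 0
     else (\<Sum>\<sigma> | c \<sigma> \<noteq> 0 \<and> \<tau> \<subseteq> \<sigma> \<and> card \<sigma> = Suc (card \<tau>). c \<sigma>))"

definition augmentation :: "('v set \<Rightarrow> bit) \<Rightarrow> bit" where
  "augmentation c = (\<Sum>\<sigma> | c \<sigma> \<noteq> 0. c \<sigma>)"

definition cycles :: "'v set set \<Rightarrow> nat \<Rightarrow> ('v set \<Rightarrow> bit) set" where
  "cycles X k = {c \<in> carrier (chain_group X k). boundary c = (\<lambda>\<tau>. 0)}"

definition reduced_cycles :: "'v set set \<Rightarrow> nat \<Rightarrow> ('v set \<Rightarrow> bit) set" where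
  "reduced_cycles X k = {c \<in> cycles X k. k = 0 \<longrightarrow> augmentation c = 0}"

definition boundaries :: "'v set set \<Rightarrow> nat \<Rightarrow> ('v set \<Rightarrow> bit) set" where
  "boundaries X k = boundary ` carrier (chain_group X (Suc k))"

definition homology :: "'v set set \<Rightarrow> nat \<Rightarrow> ('v set \<Rightarrow> bit) set monoid" where
  "homology X k = (chain_group X k)\<lparr>carrier := cycles X k\<rparr> Mod boundaries X k"

definition reduced_homology :: "'v set set \<Rightarrow> nat \<Rightarrow> ('v set \<Rightarrow> bit) set monoid" where
  "reduced_homology X k = (chain_group X k)\<lparr>carrier := reduced_cycles X k\<rparr> Mod boundaries X k"

text \<open>The map induced by an inclusion of \<open>X\<close> in \<open>Y\<close>, on homology as well as on reduced homology:
  the coset of a cycle \<open>z\<close> modulo the boundaries of \<open>X\<close> goes to the coset of \<open>z\<close> modulo those of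
  \<open>Y\<close>, which is obtained by adding all boundaries of \<open>Y\<close> to the former.\<close>

definition inclusion_map ::
    "'v set set \<Rightarrow> nat \<Rightarrow> ('v set \<Rightarrow> bit) set \<Rightarrow> ('v set \<Rightarrow> bit) set" where
  "inclusion_map Y k A = A <#>\<^bsub>chain_group Y k\<^esub> boundaries Y k"

section \<open>Persistence diagrams\<close>

text \<open>A persistence module over \<open>\<int>/2\<int>\<close> is given by its spaces \<open>M \<alpha>\<close> and maps \<open>f \<alpha> \<beta>\<close> for
  \<open>0 \<le> \<alpha> \<le> \<beta>\<close>. The spaces are abelian groups of exponent two; additive maps between them are
  automatically linear.\<close>

definition interval_space :: "real set \<Rightarrow> real \<Rightarrow> int monoid" where
  "interval_space S \<alpha> = (if \<alpha> \<in> S then integer_mod_group 2 else singleton_group 0)"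

definition interval_map :: "real set \<Rightarrow> real \<Rightarrow> real \<Rightarrow> int \<Rightarrow> int" where
  "interval_map S \<alpha> \<beta> x = (if \<alpha> \<in> S \<and> \<beta> \<in> S then x else 0)"

text \<open>A barcode is a multiplicity function on intervals. The module decomposes with barcode \<open>m\<close> if
  it is isomorphic to the direct sum of \<open>m S\<close> copies of the interval module of each \<open>S\<close>.\<close>

definition decomposes ::
    "(real \<Rightarrow> 'a monoid) \<Rightarrow> (real \<Rightarrow> real \<Rightarrow> 'a \<Rightarrow> 'a) \<Rightarrow> (real set \<Rightarrow> nat) \<Rightarrow> bool" where
  "decomposes M f m \<longleftrightarrow>
     (\<forall>S. m S > 0 \<longrightarrow> S \<noteq> {} \<and> is_interval S \<and> S \<subseteq> {0..}) \<and>
     (let J = {(S, i). i < m S} in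
      \<exists>\<phi>. (\<forall>\<alpha>\<ge>0. \<phi> \<alpha> \<in> iso (M \<alpha>) (sum_group J (\<lambda>(S, i). interval_space S \<alpha>))) \<and>
          (\<forall>\<alpha> \<beta>. 0 \<le> \<alpha> \<and> \<alpha> \<le> \<beta> \<longrightarrow> (\<forall>x\<in>carrier (M \<alpha>).
             \<phi> \<beta> (f \<alpha> \<beta> x) = (\<lambda>(S, i)\<in>J. interval_map S \<alpha> \<beta> (\<phi> \<alpha> x (S, i))))))"

text \<open>For a pointwise finite-dimensional module a barcode exists (Crawley-Boevey) and is unique
  (Krull-Remak-Schmidt-Azumaya), so the choice below is determined.\<close>

definition barcode ::
    "(real \<Rightarrow> 'a monoid) \<Rightarrow> (real \<Rightarrow> real \<Rightarrow> 'a \<Rightarrow> 'a) \<Rightarrow> real set \<Rightarrow> nat" where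
  "barcode M f = (SOME m. decomposes M f m)"

definition birth :: "real set \<Rightarrow> ereal" where
  "birth S = Inf (ereal ` S)"

definition death :: "real set \<Rightarrow> ereal" where
  "death S = Sup (ereal ` S)"

text \<open>Diagrams are multisets with possibly infinite multiplicities, as functions into \<open>enat\<close>. The
  diagonal consists of the points \<open>(x, x)\<close> with \<open>x\<close> finite. Off the diagonal the set counted is
  finite in the pointwise finite-dimensional case: all its intervals share an inner point.\<close>

definition diagram_of_barcode :: "(real set \<Rightarrow> nat) \<Rightarrow> ereal \<times> ereal \<Rightarrow> enat" where
  "diagram_of_barcode m = (\<lambda>(b, d).
     if b = d then (if \<bar>b\<bar> \<noteq> \<infinity> then \<infinity> else 0)
     else enat (card {(S, i). i < m S \<and> birth S = b \<and> death S = d}))"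

definition Dgm :: "nat \<Rightarrow> (real \<Rightarrow> 'v set set) \<Rightarrow> ereal \<times> ereal \<Rightarrow> enat" where
  "Dgm K F = diagram_of_barcode
     (barcode (\<lambda>\<alpha>. homology (F \<alpha>) K) (\<lambda>\<alpha> \<beta>. inclusion_map (F \<beta>) K))"

section \<open>Bottleneck distance\<close>

text \<open>The case distinction is needed for two infinite death times, as \<open>\<infinity> - \<infinity> = \<infinity>\<close> in \<open>ereal\<close>.\<close>

definition coord_dist :: "ereal \<Rightarrow> ereal \<Rightarrow> ereal" where
  "coord_dist x y = (if x = y then 0 else \<bar>x - y\<bar>)"

definition linf_dist :: "ereal \<times> ereal \<Rightarrow> ereal \<times> ereal \<Rightarrow> ereal" where
  "linf_dist p q = max (coord_dist (fst p) (fst q)) (coord_dist (snd p) (snd q))"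

text \<open>The elements of a multiset, with copies told apart by a number, so that bijections between
  multisets are bijections between sets.\<close>

definition points :: "('a \<Rightarrow> enat) \<Rightarrow> ('a \<times> nat) set" where
  "points D = {(p, i). enat i < D p}"

definition bottleneck_dist :: "(ereal \<times> ereal \<Rightarrow> enat) \<Rightarrow> (ereal \<times> ereal \<Rightarrow> enat) \<Rightarrow> ereal" where
  "bottleneck_dist D D' =
     (INF \<phi> \<in> {\<phi>. bij_betw \<phi> (points D) (points D')}.
        SUP p \<in> points D. linf_dist (fst p) (fst (\<phi> p)))"

section \<open>Covers and nerves\<close>

text \<open>A collection \<open>U\<^sub>0, \<dots>, U\<^sub>m\<close> of filtrations is a function \<open>U\<close> of which the values at indices
  \<open>\<le> m\<close> matter.\<close>

definition cover_inter :: "(nat \<Rightarrow> real \<Rightarrow> 'v set set) \<Rightarrow> nat set \<Rightarrow> real \<Rightarrow> 'v set set" where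
  "cover_inter U v \<alpha> = (\<Inter>i\<in>v. U i \<alpha>)"

definition cover_union :: "nat \<Rightarrow> (nat \<Rightarrow> real \<Rightarrow> 'v set set) \<Rightarrow> real \<Rightarrow> 'v set set" where
  "cover_union m U \<alpha> = (\<Union>i\<le>m. U i \<alpha>)"

definition nerve :: "nat \<Rightarrow> (nat \<Rightarrow> real \<Rightarrow> 'v set set) \<Rightarrow> real \<Rightarrow> nat set set" where
  "nerve m U \<alpha> = {\<sigma>. \<sigma> \<noteq> {} \<and> \<sigma> \<subseteq> {..m} \<and> cover_inter U \<sigma> \<alpha> \<noteq> {}}"

definition good_cover_filtration ::
    "real \<Rightarrow> nat \<Rightarrow> (nat \<Rightarrow> real \<Rightarrow> 'v set set) \<Rightarrow> (real \<Rightarrow> 'v set set) \<Rightarrow> bool" where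
  "good_cover_filtration \<epsilon> m U W \<longleftrightarrow>
     (\<forall>\<alpha>\<ge>0. W \<alpha> = cover_union m U \<alpha>) \<and>
     (\<forall>v \<alpha> k. v \<noteq> {} \<and> v \<subseteq> {..m} \<and> 0 \<le> \<alpha> \<and> cover_inter U v \<alpha> \<noteq> {} \<longrightarrow>
        (\<forall>A \<in> carrier (reduced_homology (cover_inter U v \<alpha>) k).
           inclusion_map (cover_inter U v (\<alpha> + \<epsilon>)) k A
             = \<one>\<^bsub>reduced_homology (cover_inter U v (\<alpha> + \<epsilon>)) k\<^esub>))"

end

(*
  Both the union and the nerve run through boundaries of simplices of growing dimension. At stage r
  the vertices are 0, ..., r. The cover consists of the facets of the r-simplex, so the union and the
  nerve are both the boundary of an r-simplex. At time r^2 the piece U_r, the facet opposite to 0, gains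
  the vertex 0, which all other pieces contain. This fills the nerve at once. U_r then grows by one skeleton
  of the r-simplex per unit of time, so that a reduced cycle of an intersection of pieces that is not
  already a boundary becomes one after one step. The union therefore stays the boundary of the simplex
  until U_r has become the whole simplex, r steps later. The full r-simplex is the facet opposite to the
  next vertex r + 1, and stage r + 1 starts.

  Hence in degree K = r - 1 the nerve has the bar [r(r - 1), r^2) and the union the bar
  [r(r - 1), r(r + 1)), besides the bar of a component if K = 0. The ends differ by r, and matching the
  longer bar to the diagonal also costs r. After stage m both complexes are cones with apex 0.
*)
theory Submission
  imports Defs
begin

section \<open>Chains\<close>

text \<open>The constants are forced by the diagonal. A bar of length \<open>l\<close> can be
  matched to the diagonal at cost \<open>l / 2\<close>, so a delay of \<open>r\<close> in its death
  shows in full only if \<open>l \<ge> 2 * r\<close>. Stage \<open>r\<close> therefore waits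
  \<open>r\<close> steps before the nerve is filled and takes \<open>r\<close> more until the union
  is filled; since stage \<open>r\<close> has length \<open>2 * r\<close>, it starts at
  \<open>r * (r - 1)\<close> and has its middle at \<open>r * r\<close>. Every vanishing statement
  comes from one device, the cone over a reduced cycle. Inside one complex it shows acyclicity; into
  the complex one step later it shows that the cover is 1-good. The obstacle on the side of diagrams
  is that \<open>barcode\<close> is a choice among all decompositions. It is pinned down by
  counting: the number of bars through two parameters is determined by the image of the map between
  them, and the few counts that occur leave only one family of intervals.\<close>

lemma bit_add_self: "(x :: bit) + x = 0"
  by (cases x) auto

lemma chain_carrierD:
  assumes "c \<in> carrier (chain_group X k)"
  shows "finite {\<sigma>. c \<sigma> \<noteq> 0}" "c \<sigma> \<noteq> 0 \<Longrightarrow> \<sigma> \<in> X" "c \<sigma> \<noteq> 0 \<Longrightarrow> card \<sigma> = Suc k"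
  using assms by (auto simp: chain_group_def)

lemma chain_vertices:
  assumes "c \<in> carrier (chain_group X k)"
  obtains V where "finite V" "\<And>\<sigma>. c \<sigma> \<noteq> 0 \<Longrightarrow> \<sigma> \<subseteq> V"
proof
  have "finite \<sigma>" if "c \<sigma> \<noteq> 0" for \<sigma>
    using chain_carrierD(3)[OF assms that] card_ge_0_finite[of \<sigma>] by simp
  then show "finite (\<Union>{\<sigma>. c \<sigma> \<noteq> 0})"
    using chain_carrierD(1)[OF assms] by auto
qed auto

text \<open>A coface of \<open>\<tau>\<close> of one dimension more is \<open>\<tau>\<close> with
  one vertex added. Summing over the added vertex in a fixed set \<open>V\<close>, which may be
  larger than the support of \<open>c\<close> requires, gives several chains a common index
  set.\<close>

lemma boundary_eq_sum:
  assumes V: "finite V" "\<And>\<sigma>. c \<sigma> \<noteq> 0 \<Longrightarrow> \<sigma> \<subseteq> V" and \<tau>: "\<tau> \<noteq> {}" "finite \<tau>"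
  shows "boundary c \<tau> = (\<Sum>p\<in>V - \<tau>. c (insert p \<tau>))"
proof -
  let ?A = "{\<sigma>. c \<sigma> \<noteq> 0 \<and> \<tau> \<subseteq> \<sigma> \<and> card \<sigma> = Suc (card \<tau>)}"
  have "sum c ?A = sum c ((\<lambda>p. insert p \<tau>) ` (V - \<tau>))"
  proof (rule sum.mono_neutral_left)
    show "?A \<subseteq> (\<lambda>p. insert p \<tau>) ` (V - \<tau>)"
    proof
      fix \<sigma> assume \<sigma>: "\<sigma> \<in> ?A"
      then have "card (\<sigma> - \<tau>) = 1"
        using \<tau> by (simp add: card_Diff_subset)
      then obtain p where "\<sigma> - \<tau> = {p}"
        using card_1_singletonE by blast
      moreover have "\<sigma> \<subseteq> V"
        using \<sigma> V(2) by simp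
      ultimately show "\<sigma> \<in> (\<lambda>p. insert p \<tau>) ` (V - \<tau>)"
        using \<sigma> by (auto intro!: image_eqI[of _ _ p])
    qed
  qed (use V \<tau> in auto)
  also have "\<dots> = (\<Sum>p\<in>V - \<tau>. c (insert p \<tau>))"
    by (subst sum.reindex) (auto simp: inj_on_def)
  finally show ?thesis
    using \<tau> by (simp add: boundary_def)
qed

lemma boundary_empty [simp]: "boundary c {} = 0"
  by (simp add: boundary_def)

lemma augmentation_eq_sum:
  assumes c: "c \<in> carrier (chain_group X 0)" and V: "finite V" "\<And>\<sigma>. c \<sigma> \<noteq> 0 \<Longrightarrow> \<sigma> \<subseteq> V"
  shows "augmentation c = (\<Sum>p\<in>V. c {p})"
proof -
  have "sum c {\<sigma>. c \<sigma> \<noteq> 0} = sum c ((\<lambda>p. {p}) ` V)"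
  proof (rule sum.mono_neutral_left)
    show "{\<sigma>. c \<sigma> \<noteq> 0} \<subseteq> (\<lambda>p. {p}) ` V"
    proof
      fix \<sigma> assume \<sigma>: "\<sigma> \<in> {\<sigma>. c \<sigma> \<noteq> 0}"
      then have "card \<sigma> = 1" "\<sigma> \<subseteq> V"
        using chain_carrierD(3)[OF c] V(2) by auto
      then show "\<sigma> \<in> (\<lambda>p. {p}) ` V"
        using card_1_singletonE by blast
    qed
  qed (use V in auto)
  then show ?thesis
    by (simp add: augmentation_def sum.reindex)
qed

lemma boundary_nonzeroE:
  assumes "boundary c \<tau> \<noteq> 0"
  obtains \<sigma> where "\<tau> \<noteq> {}" "c \<sigma> \<noteq> 0" "\<tau> \<subseteq> \<sigma>" "card \<sigma> = Suc (card \<tau>)"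
proof -
  have "\<tau> \<noteq> {}" using assms by auto
  moreover from this have "(\<Sum>\<sigma> | c \<sigma> \<noteq> 0 \<and> \<tau> \<subseteq> \<sigma> \<and> card \<sigma> = Suc (card \<tau>). c \<sigma>) \<noteq> 0"
    using assms by (simp add: boundary_def)
  then obtain \<sigma> where "\<sigma> \<in> {\<sigma>. c \<sigma> \<noteq> 0 \<and> \<tau> \<subseteq> \<sigma> \<and> card \<sigma> = Suc (card \<tau>)}"
    using sum.not_neutral_contains_not_neutral by blast
  ultimately show ?thesis using that by blast
qed

lemma boundary_eq_0:
  assumes "c \<in> carrier (chain_group X k)" "infinite \<tau> \<or> card \<tau> \<noteq> k"
  shows "boundary c \<tau> = 0"
proof (rule ccontr)
  assume "boundary c \<tau> \<noteq> 0"
  then obtain \<sigma> where \<sigma>: "c \<sigma> \<noteq> 0" "\<tau> \<subseteq> \<sigma>" "card \<sigma> = Suc (card \<tau>)"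
    by (rule boundary_nonzeroE)
  then have "card \<sigma> = Suc k" "finite \<sigma>"
    using chain_carrierD(3)[OF assms(1)] card_ge_0_finite[of \<sigma>] by auto
  then show False
    using assms(2) \<sigma> finite_subset by auto
qed

lemma chain_add:
  "c \<in> carrier (chain_group X k) \<Longrightarrow> d \<in> carrier (chain_group X k)
    \<Longrightarrow> (\<lambda>\<sigma>. c \<sigma> + d \<sigma>) \<in> carrier (chain_group X k)"
  by (auto simp: chain_group_def intro: finite_subset[of _ "{\<sigma>. c \<sigma> = 1} \<union> {\<sigma>. d \<sigma> = 1}"])

lemma chain_vertices2:
  assumes "c \<in> carrier (chain_group X k)" "d \<in> carrier (chain_group X k)"
  obtains V where "finite V" "\<And>\<sigma>. c \<sigma> \<noteq> 0 \<Longrightarrow> \<sigma> \<subseteq> V" "\<And>\<sigma>. d \<sigma> \<noteq> 0 \<Longrightarrow> \<sigma> \<subseteq> V"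
    "\<And>\<sigma>. c \<sigma> + d \<sigma> \<noteq> 0 \<Longrightarrow> \<sigma> \<subseteq> V"
proof -
  obtain V W where "finite V" "\<And>\<sigma>. c \<sigma> \<noteq> 0 \<Longrightarrow> \<sigma> \<subseteq> V" "finite W" "\<And>\<sigma>. d \<sigma> \<noteq> 0 \<Longrightarrow> \<sigma> \<subseteq> W"
    using assms chain_vertices by metis
  moreover from this have "\<sigma> \<subseteq> V \<union> W" if "c \<sigma> + d \<sigma> \<noteq> 0" for \<sigma>
    using that by (metis add_0 le_supI1 le_supI2)
  ultimately show ?thesis
    by (intro that[of "V \<union> W"]) auto
qed

lemma boundary_add:
  fixes c d :: "'v set \<Rightarrow> bit"
  assumes "c \<in> carrier (chain_group X k)" "d \<in> carrier (chain_group X k)"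
  shows "boundary (\<lambda>\<sigma>. c \<sigma> + d \<sigma>) = (\<lambda>\<tau>. boundary c \<tau> + boundary d \<tau>)"
proof
  fix \<tau> :: "'v set"
  obtain V where V: "finite V" "\<And>\<sigma>. c \<sigma> \<noteq> 0 \<Longrightarrow> \<sigma> \<subseteq> V" "\<And>\<sigma>. d \<sigma> \<noteq> 0 \<Longrightarrow> \<sigma> \<subseteq> V"
    "\<And>\<sigma>. c \<sigma> + d \<sigma> \<noteq> 0 \<Longrightarrow> \<sigma> \<subseteq> V"
    using chain_vertices2[OF assms] by blast
  consider "\<tau> = {}" | "infinite \<tau>" | "\<tau> \<noteq> {}" "finite \<tau>" by blast
  then show "boundary (\<lambda>\<sigma>. c \<sigma> + d \<sigma>) \<tau> = boundary c \<tau> + boundary d \<tau>"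
  proof cases
    case 2
    then show ?thesis
      using assms chain_add[OF assms] by (metis boundary_eq_0 add_0)
  next
    case 3
    have "boundary c \<tau> = (\<Sum>p\<in>V - \<tau>. c (insert p \<tau>))"
      by (rule boundary_eq_sum[OF V(1,2) 3])
    moreover have "boundary d \<tau> = (\<Sum>p\<in>V - \<tau>. d (insert p \<tau>))"
      by (rule boundary_eq_sum[OF V(1,3) 3])
    moreover have "boundary (\<lambda>\<sigma>. c \<sigma> + d \<sigma>) \<tau> = (\<Sum>p\<in>V - \<tau>. c (insert p \<tau>) + d (insert p \<tau>))"
      by (rule boundary_eq_sum[OF V(1,4) 3])
    ultimately show ?thesis
      by (simp only: sum.distrib)
  qed simp
qed

lemma augmentation_add:
  assumes "c \<in> carrier (chain_group X 0)" "d \<in> carrier (chain_group X 0)"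
  shows "augmentation (\<lambda>\<sigma>. c \<sigma> + d \<sigma>) = augmentation c + augmentation d"
proof -
  obtain V where V: "finite V" "\<And>\<sigma>. c \<sigma> \<noteq> 0 \<Longrightarrow> \<sigma> \<subseteq> V" "\<And>\<sigma>. d \<sigma> \<noteq> 0 \<Longrightarrow> \<sigma> \<subseteq> V"
    "\<And>\<sigma>. c \<sigma> + d \<sigma> \<noteq> 0 \<Longrightarrow> \<sigma> \<subseteq> V"
    using chain_vertices2[OF assms] by blast
  have "augmentation c = (\<Sum>p\<in>V. c {p})"
    by (rule augmentation_eq_sum[OF assms(1) V(1,2)])
  moreover have "augmentation d = (\<Sum>p\<in>V. d {p})"
    by (rule augmentation_eq_sum[OF assms(2) V(1,3)])
  moreover have "augmentation (\<lambda>\<sigma>. c \<sigma> + d \<sigma>) = (\<Sum>p\<in>V. c {p} + d {p})"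
    by (rule augmentation_eq_sum[OF chain_add[OF assms] V(1,4)])
  ultimately show ?thesis
    by (simp only: sum.distrib)
qed

text \<open>Each unordered pair is counted twice, which is zero in characteristic 2. With
  \<open>g p q\<close> the coefficient at the simplex enlarged by \<open>p\<close> and
  \<open>q\<close>, this makes the boundary of a boundary vanish.\<close>

lemma sum_symmetric_pairs_eq_0:
  fixes g :: "'a \<Rightarrow> 'a \<Rightarrow> bit"
  assumes "finite A" "\<And>p q. g p q = g q p"
  shows "(\<Sum>p\<in>A. \<Sum>q\<in>A - {p}. g p q) = 0"
  using assms(1)
proof (induction A)
  case (insert a A)
  have "(\<Sum>p\<in>A. \<Sum>q\<in>insert a A - {p}. g p q) = (\<Sum>p\<in>A. g p a + (\<Sum>q\<in>A - {p}. g p q))"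
    using insert by (intro sum.cong refl) (auto simp: insert_Diff_if)
  also have "\<dots> = (\<Sum>q\<in>A. g a q)"
    unfolding sum.distrib insert.IH using assms(2)[of _ a] by simp
  finally show ?case
    using insert by (simp add: bit_add_self)
qed simp

lemma boundary_chain:
  assumes X: "abstract_complex X" and c: "c \<in> carrier (chain_group X (Suc k))"
  shows "boundary c \<in> carrier (chain_group X k)"
proof -
  obtain V where V: "finite V" "\<And>\<sigma>. c \<sigma> \<noteq> 0 \<Longrightarrow> \<sigma> \<subseteq> V"
    using chain_vertices[OF c] by blast
  have *: "\<tau> \<subseteq> V \<and> \<tau> \<in> X \<and> card \<tau> = Suc k" if nz: "boundary c \<tau> \<noteq> 0" for \<tau>
  proof -
    obtain \<sigma> where \<sigma>: "\<tau> \<noteq> {}" "c \<sigma> \<noteq> 0" "\<tau> \<subseteq> \<sigma>" "card \<sigma> = Suc (card \<tau>)"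
      by (rule boundary_nonzeroE[OF nz])
    then have "\<sigma> \<in> X" "card \<sigma> = Suc (Suc k)" "\<sigma> \<subseteq> V"
      using V(2) chain_carrierD[OF c] by blast+
    moreover from this have "\<tau> \<in> X"
      using \<sigma>(1,3) X unfolding abstract_complex_def by blast
    ultimately show ?thesis
      using \<sigma>(3,4) by simp
  qed
  then show ?thesis
    using finite_subset[of "{\<tau>. boundary c \<tau> \<noteq> 0}" "Pow V"] V by (auto simp: chain_group_def)
qed

lemma boundary_boundary:
  fixes c :: "'v set \<Rightarrow> bit"
  assumes X: "abstract_complex X" and c: "c \<in> carrier (chain_group X (Suc k))"
  shows "boundary (boundary c) = (\<lambda>\<tau>. 0)"
proof
  fix \<rho> :: "'v set"
  obtain V where V: "finite V" "\<And>\<sigma>. c \<sigma> \<noteq> 0 \<Longrightarrow> \<sigma> \<subseteq> V"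
    using chain_vertices[OF c] by blast
  have V': "\<tau> \<subseteq> V" if nz: "boundary c \<tau> \<noteq> 0" for \<tau>
    using nz V(2) by (metis boundary_nonzeroE subset_trans)
  consider "\<rho> = {}" | "infinite \<rho>" | "\<rho> \<noteq> {}" "finite \<rho>" by blast
  then show "boundary (boundary c) \<rho> = 0"
  proof cases
    case 2
    then show ?thesis using boundary_eq_0[OF boundary_chain[OF assms]] by blast
  next
    case 3
    have "boundary (boundary c) \<rho> = (\<Sum>p\<in>V - \<rho>. boundary c (insert p \<rho>))"
      using 3 V V' by (intro boundary_eq_sum) auto
    also have "\<dots> = (\<Sum>p\<in>V - \<rho>. \<Sum>q\<in>(V - \<rho>) - {p}. c (insert q (insert p \<rho>)))"
    proof (intro sum.cong refl)
      fix p
      have "V - insert p \<rho> = V - \<rho> - {p}" by auto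
      then show "boundary c (insert p \<rho>) = (\<Sum>q\<in>(V - \<rho>) - {p}. c (insert q (insert p \<rho>)))"
        using 3 V boundary_eq_sum[of V c "insert p \<rho>"] by simp
    qed
    also have "\<dots> = 0"
      using V by (intro sum_symmetric_pairs_eq_0) (auto simp: insert_commute)
    finally show ?thesis .
  qed simp
qed

lemma augmentation_boundary:
  assumes X: "abstract_complex X" and c: "c \<in> carrier (chain_group X 1)"
  shows "augmentation (boundary c) = 0"
proof -
  obtain V where V: "finite V" "\<And>\<sigma>. c \<sigma> \<noteq> 0 \<Longrightarrow> \<sigma> \<subseteq> V"
    using chain_vertices[OF c] by blast
  have V': "\<tau> \<subseteq> V" if nz: "boundary c \<tau> \<noteq> 0" for \<tau>
    using nz V(2) by (metis boundary_nonzeroE subset_trans)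
  have "augmentation (boundary c) = (\<Sum>p\<in>V. boundary c {p})"
    using boundary_chain[OF X] c V V' by (intro augmentation_eq_sum) auto
  also have "\<dots> = (\<Sum>p\<in>V. \<Sum>q\<in>V - {p}. c {q, p})"
    using V boundary_eq_sum[of V c] by simp
  also have "\<dots> = 0"
    using V by (intro sum_symmetric_pairs_eq_0) (auto simp: insert_commute)
  finally show ?thesis .
qed

text \<open>The boundary of a cone is its base plus the cone over the boundary of the base, and the
  latter vanishes for a reduced cycle. Simplices of \<open>c\<close> that contain \<open>p\<close>
  are dropped by the cone; the cycle condition restores their coefficients.\<close>

lemma boundary_cone:
  fixes c :: "'v set \<Rightarrow> bit"
  assumes c: "c \<in> reduced_cycles X k"
  shows "boundary (\<lambda>\<tau>. if p \<in> \<tau> then c (\<tau> - {p}) else 0) = c"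
proof
  fix \<tau> :: "'v set"
  let ?d = "\<lambda>\<tau>. if p \<in> \<tau> then c (\<tau> - {p}) else 0"
  have c': "c \<in> carrier (chain_group X k)" and bd: "boundary c \<sigma> = 0" for \<sigma>
    using c by (auto simp: reduced_cycles_def cycles_def)
  obtain V0 where V0: "finite V0" "\<And>\<sigma>. c \<sigma> \<noteq> 0 \<Longrightarrow> \<sigma> \<subseteq> V0"
    using chain_vertices[OF c'] by blast
  define V where "V = insert p V0"
  have V: "finite V" "p \<in> V" "\<And>\<sigma>. c \<sigma> \<noteq> 0 \<Longrightarrow> \<sigma> \<subseteq> V" "\<And>\<sigma>. ?d \<sigma> \<noteq> 0 \<Longrightarrow> \<sigma> \<subseteq> V"
    using V0 by (auto simp: V_def split: if_splits)
  have fin: "finite \<sigma>" "\<sigma> \<noteq> {}" if "c \<sigma> \<noteq> 0" for \<sigma>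
    using chain_carrierD(3)[OF c' that] card_ge_0_finite[of \<sigma>] by auto
  consider "\<tau> = {}" | "infinite \<tau>" | "\<tau> \<noteq> {}" "finite \<tau>" by blast
  then show "boundary ?d \<tau> = c \<tau>"
  proof cases
    case 1
    then show ?thesis using fin(2)[of "{}"] by (cases "c {}") auto
  next
    case 2
    have "boundary ?d \<tau> = 0"
    proof (rule ccontr)
      assume "boundary ?d \<tau> \<noteq> 0"
      then obtain \<sigma> where \<sigma>: "?d \<sigma> \<noteq> 0" "\<tau> \<subseteq> \<sigma>"
        by (rule boundary_nonzeroE)
      have "\<tau> \<subseteq> V"
        using \<sigma>(2) V(4)[OF \<sigma>(1)] by (rule subset_trans)
      then show False
        using V(1) 2 finite_subset by auto
    qed
    then show ?thesis using 2 fin(1)[of \<tau>] by (cases "c \<tau>") auto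
  next
    case 3
    have eq: "boundary ?d \<tau> = (\<Sum>q\<in>V - \<tau>. ?d (insert q \<tau>))"
      using 3 V by (intro boundary_eq_sum) auto
    show ?thesis
    proof (cases "p \<in> \<tau>")
      case False
      then have "(\<Sum>q\<in>V - \<tau>. ?d (insert q \<tau>)) = (\<Sum>q\<in>V - \<tau>. if q = p then c \<tau> else 0)"
        by (intro sum.cong) auto
      then show ?thesis
        using eq False V by simp
    next
      case True
      \<comment> \<open>The boundary of the cone at \<open>\<tau>\<close> is the boundary of
        \<open>c\<close> at \<open>\<rho>\<close> without the summand for \<open>p\<close>. The full
        sum is zero, so what remains equals that summand, \<open>c \<tau>\<close>.\<close>
      define \<rho> where "\<rho> = \<tau> - {p}"
      have \<tau>: "\<tau> = insert p \<rho>" "p \<notin> \<rho>" using True by (auto simp: \<rho>_def)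
      have "(\<Sum>q\<in>V - \<tau>. ?d (insert q \<tau>)) = (\<Sum>q\<in>V - \<rho> - {p}. c (insert q \<rho>))"
        using \<tau> by (intro sum.cong) (auto simp: insert_Diff_if)
      moreover have "(\<Sum>q\<in>V - \<rho>. c (insert q \<rho>)) = 0"
      \<comment> \<open>\<open>boundary\<close> is set to 0 at the empty set and says nothing there;
        in degree 0 the augmentation takes its place, which is why the cycle has to be
        reduced.\<close>
      proof (cases "\<rho> = {}")
        case empty: True
        show ?thesis
        proof (cases k)
          case 0
          then have "augmentation c = 0" using c by (simp add: reduced_cycles_def)
          then show ?thesis
            using augmentation_eq_sum[of c X V] c' V 0 empty by simp
        next
          case (Suc j)
          have "c {q} = 0" for q
            using chain_carrierD(3)[OF c', of "{q}"] Suc by fastforce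
          then show ?thesis using empty by simp
        qed
      next
        case False
        then show ?thesis
          using boundary_eq_sum[of V c \<rho>] V 3 bd \<tau> by simp
      qed
      moreover have "(\<Sum>q\<in>V - \<rho>. c (insert q \<rho>)) = c \<tau> + (\<Sum>q\<in>V - \<rho> - {p}. c (insert q \<rho>))"
        using V \<tau> by (subst sum.remove[of _ p]) auto
      ultimately show ?thesis
        using eq by (metis add_cancel_right_right add.assoc bit_add_self)
    qed
  qed
qed

text \<open>Only the simplices of dimension \<open>k\<close> have to be joined with
  \<open>p\<close>, so \<open>Y\<close> need not be a cone. This lets a skeleton of one dimension
  more suffice as a target.\<close>

lemma cone_in_boundaries:
  assumes c: "c \<in> reduced_cycles X k" and p: "\<And>\<sigma>. \<sigma> \<in> X \<Longrightarrow> card \<sigma> = Suc k \<Longrightarrow> insert p \<sigma> \<in> Y"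
  shows "c \<in> boundaries Y k"
proof -
  have c': "c \<in> carrier (chain_group X k)"
    using c by (auto simp: reduced_cycles_def cycles_def)
  let ?d = "\<lambda>\<tau>. if p \<in> \<tau> then c (\<tau> - {p}) else 0"
  have d: "?d \<in> carrier (chain_group Y (Suc k))"
  proof -
    have "{\<sigma>. ?d \<sigma> \<noteq> 0} \<subseteq> insert p ` {\<sigma>. c \<sigma> \<noteq> 0}"
      by (auto split: if_splits intro!: image_eqI[of _ _ "_ - {p}"])
    then have "finite {\<sigma>. ?d \<sigma> \<noteq> 0}"
      using chain_carrierD(1)[OF c'] by (meson finite_imageI finite_subset)
    moreover have "\<sigma> \<in> Y \<and> card \<sigma> = Suc (Suc k)" if "?d \<sigma> \<noteq> 0" for \<sigma>
    proof -
      have \<sigma>: "p \<in> \<sigma>" "c (\<sigma> - {p}) \<noteq> 0"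
        using that by (auto split: if_splits)
      then have "\<sigma> - {p} \<in> X" and card: "card (\<sigma> - {p}) = Suc k"
        using chain_carrierD(2,3)[OF c'] by blast+
      moreover have "finite \<sigma>"
        using card card_ge_0_finite[of "\<sigma> - {p}"] by simp
      ultimately show ?thesis
        using p[of "\<sigma> - {p}"] \<sigma>(1) card_Suc_Diff1[of \<sigma> p] by (simp add: insert_absorb)
    qed
    ultimately show ?thesis
      by (auto simp: chain_group_def)
  qed
  show ?thesis
    unfolding boundaries_def using imageI[OF d, of boundary] boundary_cone[OF c, of p] by (simp only:)
qed

section \<open>Barcodes\<close>

definition bars :: "(real set \<Rightarrow> nat) \<Rightarrow> real \<Rightarrow> real \<Rightarrow> (real set \<times> nat) set" where
  "bars m \<alpha> \<beta> = {(S, i). i < m S \<and> \<alpha> \<in> S \<and> \<beta> \<in> S}"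

lemma group_interval_space: "group (interval_space S \<alpha>)"
  by (simp add: interval_space_def)

lemma carrier_interval_space: "carrier (interval_space S \<alpha>) = (if \<alpha> \<in> S then {0, 1} else {0})"
  by (auto simp: interval_space_def carrier_integer_mod_group singleton_group_def)

lemma one_interval_space: "\<one>\<^bsub>interval_space S \<alpha>\<^esub> = 0"
  by (simp add: interval_space_def singleton_group_def)

lemma carrier_sum_interval_space:
  "carrier (sum_group J (\<lambda>(S, i). interval_space S \<alpha>)) =
     {x \<in> extensional J. (\<forall>(S, i)\<in>J. x (S, i) \<in> (if \<alpha> \<in> S then {0, 1} else {0})) \<and>
        finite {j\<in>J. x j \<noteq> 0}}"
proof -
  have "group ((\<lambda>(S, i). interval_space S \<alpha>) j)" for j :: "real set \<times> nat"
    by (simp add: group_interval_space split: prod.split)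
  moreover have "\<one>\<^bsub>(\<lambda>(S, i). interval_space S \<alpha>) j\<^esub> = 0" for j :: "real set \<times> nat"
    by (simp add: one_interval_space split: prod.split)
  moreover have "carrier ((\<lambda>(S, i). interval_space S \<alpha>) j) = (if \<alpha> \<in> fst j then {0, 1} else {0})"
    for j :: "real set \<times> nat"
    by (simp add: carrier_interval_space split: prod.split)
  ultimately show ?thesis
    by (subst carrier_sum_group) (auto simp: PiE_iff split_beta)
qed

text \<open>A persistence module determines, for every \<open>\<alpha> \<le> \<beta>\<close>, the number of bars containing both: the
  image of the map from \<open>\<alpha>\<close> to \<open>\<beta>\<close> is the sum of the interval spaces of these bars.\<close>

lemma decomposes_image_bij:
  assumes dec: "decomposes M f m" and le: "0 \<le> \<alpha>" "\<alpha> \<le> \<beta>"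
    and f: "\<And>x. x \<in> carrier (M \<alpha>) \<Longrightarrow> f \<alpha> \<beta> x \<in> carrier (M \<beta>)"
  shows "\<exists>g. bij_betw g (f \<alpha> \<beta> ` carrier (M \<alpha>)) (Fpow (bars m \<alpha> \<beta>))"
proof -
  define J where "J = {(S, i). i < m S}"
  obtain \<phi> where iso: "\<And>\<alpha>. 0 \<le> \<alpha> \<Longrightarrow> \<phi> \<alpha> \<in> iso (M \<alpha>) (sum_group J (\<lambda>(S, i). interval_space S \<alpha>))"
    and nat: "\<And>\<alpha> \<beta> x. 0 \<le> \<alpha> \<Longrightarrow> \<alpha> \<le> \<beta> \<Longrightarrow> x \<in> carrier (M \<alpha>) \<Longrightarrow>
       \<phi> \<beta> (f \<alpha> \<beta> x) = (\<lambda>(S, i)\<in>J. interval_map S \<alpha> \<beta> (\<phi> \<alpha> x (S, i)))"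
    using dec unfolding decomposes_def J_def Let_def by blast
  have bij\<alpha>: "bij_betw (\<phi> \<alpha>) (carrier (M \<alpha>)) (carrier (sum_group J (\<lambda>(S, i). interval_space S \<alpha>)))"
    and bij\<beta>: "bij_betw (\<phi> \<beta>) (carrier (M \<beta>)) (carrier (sum_group J (\<lambda>(S, i). interval_space S \<beta>)))"
    using iso[of \<alpha>] iso[of \<beta>] le by (auto simp: iso_def)
  \<comment> \<open>Over the field with two elements a vector is determined by its support, so the
    image is described by the sets of bars on which an element is nonzero.\<close>
  let ?g = "\<lambda>x. {j\<in>J. \<phi> \<beta> x j \<noteq> 0}"
  have bars: "bars m \<alpha> \<beta> = {(S, i) \<in> J. \<alpha> \<in> S \<and> \<beta> \<in> S}"
    by (auto simp: bars_def J_def)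
  have supp: "?g (f \<alpha> \<beta> x) = {(S, i) \<in> J. \<alpha> \<in> S \<and> \<beta> \<in> S \<and> \<phi> \<alpha> x (S, i) \<noteq> 0}"
    if "x \<in> carrier (M \<alpha>)" for x
    using nat[OF le that] by (auto simp: interval_map_def split: if_splits)
  have "inj_on ?g (f \<alpha> \<beta> ` carrier (M \<alpha>))"
  proof (rule inj_onI)
    fix x y assume xy: "x \<in> f \<alpha> \<beta> ` carrier (M \<alpha>)" "y \<in> f \<alpha> \<beta> ` carrier (M \<alpha>)" and eq: "?g x = ?g y"
    have xyM: "x \<in> carrier (M \<beta>)" "y \<in> carrier (M \<beta>)"
      using xy f by auto
    then have *: "\<phi> \<beta> x \<in> carrier (sum_group J (\<lambda>(S, i). interval_space S \<beta>))"
      "\<phi> \<beta> y \<in> carrier (sum_group J (\<lambda>(S, i). interval_space S \<beta>))"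
      using bij\<beta> bij_betwE by blast+
    have "\<phi> \<beta> x = \<phi> \<beta> y"
    proof (rule extensionalityI[of _ J])
      show "\<phi> \<beta> x \<in> extensional J" "\<phi> \<beta> y \<in> extensional J"
        using * by (simp_all add: carrier_sum_interval_space)
    next
      fix j assume j: "j \<in> J"
      obtain S i where Si: "j = (S, i)" by force
      have "\<phi> \<beta> x j \<in> {0, 1}" "\<phi> \<beta> y j \<in> {0, 1}"
        using * j unfolding carrier_sum_interval_space Si by (auto split: if_splits)
      moreover have "\<phi> \<beta> x j \<noteq> 0 \<longleftrightarrow> \<phi> \<beta> y j \<noteq> 0"
        using eq j by blast
      ultimately show "\<phi> \<beta> x j = \<phi> \<beta> y j" by auto
    qed
    then show "x = y"
      using xyM bij\<beta> by (meson bij_betw_imp_inj_on inj_onD)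
  qed
  moreover have "?g ` f \<alpha> \<beta> ` carrier (M \<alpha>) = Fpow (bars m \<alpha> \<beta>)"
  proof (intro equalityI subsetI)
    fix A assume "A \<in> ?g ` f \<alpha> \<beta> ` carrier (M \<alpha>)"
    then obtain x where x: "x \<in> carrier (M \<alpha>)" and A: "A = ?g (f \<alpha> \<beta> x)" by auto
    have "finite {j\<in>J. \<phi> \<beta> (f \<alpha> \<beta> x) j \<noteq> 0}"
      using f[OF x] bij\<beta> bij_betwE unfolding carrier_sum_interval_space by blast
    then show "A \<in> Fpow (bars m \<alpha> \<beta>)"
      using supp[OF x] by (auto simp: A bars Fpow_def)
  next
    fix A assume A: "A \<in> Fpow (bars m \<alpha> \<beta>)"
    \<comment> \<open>The indicator of \<open>A\<close> exists at \<alpha> because every bar in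
      \<open>A\<close> contains \<alpha>, and it survives to \<beta> because these bars contain
      \<beta> as well.\<close>
    let ?y = "\<lambda>j\<in>J. if j \<in> A then 1 else 0 :: int"
    have "{j\<in>J. ?y j \<noteq> 0} \<subseteq> A" by auto
    then have "finite {j\<in>J. ?y j \<noteq> 0}"
      using A finite_subset by (auto simp: Fpow_def)
    then have "?y \<in> carrier (sum_group J (\<lambda>(S, i). interval_space S \<alpha>))"
      using A unfolding carrier_sum_interval_space by (auto simp: Fpow_def bars)
    then obtain x where x: "x \<in> carrier (M \<alpha>)" "\<phi> \<alpha> x = ?y"
      using bij\<alpha> by (metis (no_types, lifting) bij_betw_imp_surj_on imageE)
    have "A = ?g (f \<alpha> \<beta> x)"
      using A unfolding supp[OF x(1)] x(2) by (auto simp: Fpow_def bars split: if_splits)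
    then show "A \<in> ?g ` f \<alpha> \<beta> ` carrier (M \<alpha>)"
      using x by auto
  qed
  ultimately show ?thesis
    by (auto simp: bij_betw_def)
qed

lemma finite_Fpow_iff: "finite (Fpow A) \<longleftrightarrow> finite A"
proof
  assume "finite (Fpow A)"
  moreover have "(\<lambda>x. {x}) ` A \<subseteq> Fpow A" by (auto simp: Fpow_def)
  ultimately have "finite ((\<lambda>x. {x}) ` A)" using finite_subset by blast
  then show "finite A" by (rule finite_imageD) simp
next
  assume "finite A"
  then show "finite (Fpow A)"
    using finite_subset[OF Fpow_subset_Pow] by auto
qed

lemma Fpow_eq_Pow: "finite A \<Longrightarrow> Fpow A = Pow A"
  using finite_subset by (auto simp: Fpow_def)

text \<open>The finite sets of bars of both barcodes correspond to the same image, so they are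
  equinumerous, and the number of bars is the exponent in a power of 2. Finiteness is transferred
  first, since \<open>card\<close> does not tell an infinite set from the empty one.\<close>

lemma card_bars_unique:
  assumes "decomposes M f m" "decomposes M f m'" "0 \<le> \<alpha>" "\<alpha> \<le> \<beta>"
    and "\<And>x. x \<in> carrier (M \<alpha>) \<Longrightarrow> f \<alpha> \<beta> x \<in> carrier (M \<beta>)"
    and fin: "finite (bars m' \<alpha> \<beta>)"
  shows "finite (bars m \<alpha> \<beta>)" "card (bars m \<alpha> \<beta>) = card (bars m' \<alpha> \<beta>)"
proof -
  obtain g g' where "bij_betw g (f \<alpha> \<beta> ` carrier (M \<alpha>)) (Fpow (bars m \<alpha> \<beta>))"
    and "bij_betw g' (f \<alpha> \<beta> ` carrier (M \<alpha>)) (Fpow (bars m' \<alpha> \<beta>))"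
    using decomposes_image_bij[of M f _ \<alpha> \<beta>] assms(1-5) by meson
  then obtain h where h: "bij_betw h (Fpow (bars m \<alpha> \<beta>)) (Fpow (bars m' \<alpha> \<beta>))"
    using bij_betw_inv_into bij_betw_trans by blast
  show fin': "finite (bars m \<alpha> \<beta>)"
    using bij_betw_finite[OF h] fin finite_Fpow_iff by blast
  have "card (Pow (bars m \<alpha> \<beta>)) = card (Pow (bars m' \<alpha> \<beta>))"
    using bij_betw_same_card[OF h] fin fin' Fpow_eq_Pow by metis
  then show "card (bars m \<alpha> \<beta>) = card (bars m' \<alpha> \<beta>)"
    using fin fin' by (simp add: card_Pow)
qed

section \<open>Barcodes with one finite bar and possibly one infinite bar\<close>

definition single_bar :: "bool \<Rightarrow> real \<Rightarrow> real \<Rightarrow> real set \<Rightarrow> nat" where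
  "single_bar e b d S = of_bool (S = {b..<d}) + of_bool (e \<and> S = {0..})"

lemma ico_neq_ici: "{b..<d} \<noteq> {0::real..}"
proof
  assume "{b..<d} = {0..}"
  then have "max 0 d \<in> {b..<d}" by auto
  then show False by auto
qed

lemma less_single_bar_iff:
  "i < single_bar e b d S \<longleftrightarrow> i = 0 \<and> (S = {b..<d} \<or> e \<and> S = {0..})"
  using ico_neq_ici[of b d]
  by (cases "S = {b..<d}"; cases "S = {0..}") (simp_all add: single_bar_def)

lemma bars_single_bar:
  "bars (single_bar e b d) \<alpha> \<beta> =
    (if \<alpha> \<in> {b..<d} \<and> \<beta> \<in> {b..<d} then {({b..<d}, 0)} else {}) \<union>
    (if e \<and> \<alpha> \<in> {0..} \<and> \<beta> \<in> {0..} then {({0..}, 0)} else {})"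
    (is "_ = ?R")
proof (rule Set.set_eqI)
  fix p :: "real set \<times> nat"
  obtain S i where p: "p = (S, i)" by force
  have "(S, i) \<in> bars (single_bar e b d) \<alpha> \<beta> \<longleftrightarrow>
      i = 0 \<and> (S = {b..<d} \<or> e \<and> S = {0..}) \<and> \<alpha> \<in> S \<and> \<beta> \<in> S"
    by (simp only: bars_def less_single_bar_iff mem_Collect_eq prod.case conj_assoc)
  also have "\<dots> \<longleftrightarrow> (S, i) \<in> ?R"
    by (cases "S = {b..<d}"; cases "S = {0..}") (simp_all del: atLeastLessThan_iff atLeast_iff)
  finally show "p \<in> bars (single_bar e b d) \<alpha> \<beta> \<longleftrightarrow> p \<in> ?R"
    unfolding p .
qed

lemma finite_bars_single_bar: "finite (bars (single_bar e b d) \<alpha> \<beta>)"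
  by (simp add: bars_single_bar)

lemma card_bars_single_bar:
  assumes "b < d" "0 \<le> \<alpha>" "\<alpha> \<le> \<beta>"
  shows "card (bars (single_bar e b d) \<alpha> \<beta>) = of_bool (b \<le> \<alpha> \<and> \<beta> < d) + of_bool e"
  using assms ico_neq_ici[of b d] by (auto simp: bars_single_bar)

lemma multiplicity_eq_card: "m S = card {i. (S, i) \<in> {(S, i). i < m S}}"
  by simp

text \<open>Without the infinite bar, exactly one bar passes through \<open>b\<close>, and for each
  \<open>x\<close> from \<open>b\<close> up to \<open>d\<close> the bar through \<open>b\<close> and
  \<open>x\<close> must be this one. With it, the bar through \<open>0\<close> and \<open>d\<close>
  reaches all later \<open>x\<close>, and the second bar through \<open>0\<close> is the finite one.
  Any further bar would be counted at one of its own points.\<close>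

lemma single_bar_unique:
  assumes m: "\<And>S. m S > 0 \<Longrightarrow> S \<noteq> {} \<and> is_interval S \<and> S \<subseteq> {0..}"
    and fin: "\<And>\<alpha> \<beta>. 0 \<le> \<alpha> \<Longrightarrow> \<alpha> \<le> \<beta> \<Longrightarrow> finite (bars m \<alpha> \<beta>)"
    and card: "\<And>\<alpha> \<beta>. 0 \<le> \<alpha> \<Longrightarrow> \<alpha> \<le> \<beta> \<Longrightarrow> card (bars m \<alpha> \<beta>) = of_bool (b \<le> \<alpha> \<and> \<beta> < d) + of_bool e"
    and b: "0 \<le> b" "b < d" "e \<Longrightarrow> b = 0"
  shows "m = single_bar e b d"
proof -
  have conv: "x \<in> S" if "i < m S" "p \<in> S" "q \<in> S" "p \<le> x" "x \<le> q" for S i p q and x :: real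
  proof -
    have "is_interval S" using m[of S] that(1) by simp
    then show ?thesis using that(2-) by (rule mem_is_interval_1_I)
  qed
  have nonneg: "0 \<le> x" if "i < m S" "x \<in> S" for S i and x :: real
    using m[of S] that by auto
  have nonempty: "\<exists>x. x \<in> S" if "i < m S" for S i
    using m[of S] that by auto
  have mem: "(S, i) \<in> bars m \<alpha> \<beta> \<longleftrightarrow> i < m S \<and> \<alpha> \<in> S \<and> \<beta> \<in> S" for S i \<alpha> \<beta>
    by (simp add: bars_def)
  have ex: "\<exists>i j. {(S, i). i < m S} = insert ({b..<d}, i) (if e then {({0..}, j)} else {})"
  proof (cases e)
    case False
    have "card (bars m b b) = 1"
      using card[of b b] b False by simp
    then obtain A i where Ai: "bars m b b = {(A, i)}"
      using card_1_singletonE by (metis surj_pair)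
    then have "(A, i) \<in> bars m b b"
      by simp
    then have i: "i < m A" "b \<in> A"
      unfolding mem by auto
    have sub: "x \<in> {b..<d}" if "j < m S" "x \<in> S" for x S j
    proof -
      have "(S, j) \<in> bars m x x" "0 \<le> x"
        using that nonneg[OF that] by (simp_all add: mem)
      then have "card (bars m x x) \<noteq> 0"
        using fin[of x x] by auto
      then show ?thesis
        using card[of x x] \<open>0 \<le> x\<close> False by (simp split: if_splits)
    qed
    have "A = {b..<d}"
    proof (intro equalityI subsetI)
      fix x assume x: "x \<in> {b..<d}"
      then have "card (bars m b x) = 1"
        using card[of b x] b False by simp
      then obtain S j where "(S, j) \<in> bars m b x"
        using card_1_singletonE by (metis insertI1 surj_pair)
      moreover from this have "(S, j) \<in> bars m b b"
        by (simp add: mem)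
      ultimately show "x \<in> A"
        using Ai mem by auto
    qed (use sub i in blast)
    have "(S, j) = (A, i)" if j: "j < m S" for S j
    proof -
      obtain x where x: "x \<in> S" using nonempty[OF j] by blast
      then have "x \<in> {b..<d}" using sub j by blast
      then have "card (bars m x x) = 1"
        using card[of x x] b False by simp
      moreover have "(S, j) \<in> bars m x x" "(A, i) \<in> bars m x x"
        using x j i \<open>x \<in> {b..<d}\<close> \<open>A = {b..<d}\<close> by (simp_all add: mem)
      ultimately show ?thesis
        by (metis card_1_singletonE singletonD)
    qed
    then have "j < m S \<longleftrightarrow> (S, j) = (A, i)" for S j
      using i(1) by blast
    then have "{(S, j). j < m S} = {(A, i)}"
      by auto
    then show ?thesis
      unfolding \<open>A = {b..<d}\<close> using False by auto
  next
    case True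
    then have b0: "b = 0" using b by simp
    have c: "card (bars m \<alpha> \<beta>) = of_bool (\<beta> < d) + 1" if "0 \<le> \<alpha>" "\<alpha> \<le> \<beta>" for \<alpha> \<beta>
      using card[OF that] that True b0 by simp
    have "card (bars m 0 d) = 1"
      using c[of 0 d] b b0 by simp
    then obtain A i where Ai: "bars m 0 d = {(A, i)}"
      using card_1_singletonE by (metis surj_pair)
    then have "(A, i) \<in> bars m 0 d"
      by simp
    then have i: "i < m A" "0 \<in> A" "d \<in> A"
      unfolding mem by auto
    have A: "A = {0..}"
    proof (intro equalityI subsetI)
      fix x :: real assume x: "x \<in> {0..}"
      show "x \<in> A"
      proof (cases "x \<le> d")
        case True
        then show ?thesis using conv[of i A 0 d x] i x by simp
      next
        case False
        then have "card (bars m 0 x) = 1"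
          using c[of 0 x] x by simp
        then obtain S j where "(S, j) \<in> bars m 0 x"
          using card_1_singletonE by (metis insertI1 surj_pair)
        moreover from this have "(S, j) \<in> bars m 0 d"
          using conv[of j S 0 x d] False b b0 by (auto simp: mem)
        ultimately show ?thesis
          using Ai mem by auto
      qed
    qed (use nonneg i in auto)
    have "card (bars m 0 0) = 2" "(A, i) \<in> bars m 0 0"
      using c[of 0 0] b b0 i by (simp_all add: mem)
    then have "card (bars m 0 0 - {(A, i)}) = 1"
      by (simp add: card_Diff_singleton)
    then obtain B j where "bars m 0 0 - {(A, i)} = {(B, j)}"
      using card_1_singletonE by (metis surj_pair)
    then have Bj: "bars m 0 0 = {(A, i), (B, j)}" "(B, j) \<noteq> (A, i)"
      using \<open>(A, i) \<in> bars m 0 0\<close> by blast+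
    then have "(B, j) \<in> bars m 0 0"
      by simp
    then have j: "j < m B" "0 \<in> B"
      unfolding mem by auto
    have B: "B = {0..<d}"
    proof (intro equalityI subsetI)
      fix x assume x: "x \<in> {0..<d}"
      have "bars m 0 x \<subseteq> bars m 0 0" by (auto simp: bars_def)
      moreover have "card (bars m 0 x) = card (bars m 0 0)"
        using c[of 0 x] c[of 0 0] x by simp
      ultimately have "bars m 0 x = bars m 0 0"
        using fin[of 0 0] by (simp add: card_subset_eq)
      then have "(B, j) \<in> bars m 0 x"
        using Bj(1) by simp
      then show "x \<in> B"
        by (simp add: mem)
    next
      fix x assume x: "x \<in> B"
      have "\<not> d \<le> x"
      proof
        assume "d \<le> x"
        then have "(B, j) \<in> bars m 0 d"
          using conv[of j B 0 x d] j x b b0 by (simp add: mem)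
        then show False using Ai Bj by auto
      qed
      then show "x \<in> {0..<d}"
        using nonneg[OF j(1) x] by simp
    qed
    have "(S, k) \<in> {(A, i), (B, j)}" if k: "k < m S" for S k
    proof -
      obtain x where x: "x \<in> S" using nonempty[OF k] by blast
      then have "0 \<le> x" using nonneg k by blast
      have in1: "(S, k) \<in> bars m x x" "(A, i) \<in> bars m x x"
        using x k i A \<open>0 \<le> x\<close> by (simp_all add: mem)
      show ?thesis
      proof (cases "x < d")
        case True
        have "{(A, i), (B, j)} \<subseteq> bars m x x"
          using in1 j B True \<open>0 \<le> x\<close> by (simp add: mem)
        moreover have "card {(A, i), (B, j)} = 2"
          using Bj(2) by (metis card_2_iff)
        moreover have "card (bars m x x) = 2"
          using c[of x x] True \<open>0 \<le> x\<close> by simp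
        ultimately have "{(A, i), (B, j)} = bars m x x"
          using fin[of x x] \<open>0 \<le> x\<close> by (simp add: card_subset_eq)
        then show ?thesis using in1 by simp
      next
        case False
        then have "card (bars m x x) = 1"
          using c[of x x] \<open>0 \<le> x\<close> by simp
        then show ?thesis
          using in1 by (metis card_1_singletonE insertI1 singletonD)
      qed
    qed
    then have "k < m S \<longleftrightarrow> (S, k) = (B, j) \<or> (S, k) = (A, i)" for S k
      using i(1) j(1) by blast
    then have "{(S, k). k < m S} = {(B, j), (A, i)}"
      by auto
    then show ?thesis
      unfolding A B b0 using True by auto
  qed
  then obtain i j where eq: "{(S, i). i < m S} = insert ({b..<d}, i) (if e then {({0..}, j)} else {})"
    by blast
  show ?thesis
  proof
    fix S
    have "{k. (S, k) \<in> insert ({b..<d}, i) (if e then {({0..}, j)} else {})} =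
        (if S = {b..<d} then {i} else if e \<and> S = {0..} then {j} else {})"
      using ico_neq_ici[of b d] by auto
    then have "m S = card (if S = {b..<d} then {i} else if e \<and> S = {0..} then {j} else {})"
      using multiplicity_eq_card[of m S] unfolding eq by simp
    then show "m S = single_bar e b d S"
      using ico_neq_ici[of b d] by (auto simp: single_bar_def split: if_splits)
  qed
qed

text \<open>Whatever \<open>barcode\<close> chooses is a decomposition, hence has the same counts as
  the given one, and these determine it.\<close>

lemma barcode_eq_single_bar:
  assumes dec: "decomposes M f (single_bar e b d)"
    and f: "\<And>\<alpha> \<beta> x. 0 \<le> \<alpha> \<Longrightarrow> \<alpha> \<le> \<beta> \<Longrightarrow> x \<in> carrier (M \<alpha>) \<Longrightarrow> f \<alpha> \<beta> x \<in> carrier (M \<beta>)"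
    and b: "0 \<le> b" "b < d" "e \<Longrightarrow> b = 0"
  shows "barcode M f = single_bar e b d"
proof (rule single_bar_unique[OF _ _ _ b])
  have dec': "decomposes M f (barcode M f)"
    unfolding barcode_def using dec by (rule someI[of "decomposes M f"])
  show "S \<noteq> {} \<and> is_interval S \<and> S \<subseteq> {0..}" if "barcode M f S > 0" for S
    using dec' that by (simp add: decomposes_def)
  fix \<alpha> \<beta> :: real assume ab: "0 \<le> \<alpha>" "\<alpha> \<le> \<beta>"
  note unique = card_bars_unique[OF dec' dec ab f[OF ab] finite_bars_single_bar]
  show "finite (bars (barcode M f) \<alpha> \<beta>)"
    by (rule unique(1))
  have "card (bars (barcode M f) \<alpha> \<beta>) = card (bars (single_bar e b d) \<alpha> \<beta>)"
    by (rule unique(2))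
  also have "\<dots> = of_bool (b \<le> \<alpha> \<and> \<beta> < d) + of_bool e"
    by (rule card_bars_single_bar[OF b(2) ab])
  finally show "card (bars (barcode M f) \<alpha> \<beta>) = of_bool (b \<le> \<alpha> \<and> \<beta> < d) + of_bool e" .
qed

section \<open>Homology of filtrations\<close>

declare add_bit_eq_xor [simp del]

lemma boundary_zero [simp]: "boundary (\<lambda>\<sigma>. 0) = (\<lambda>\<tau>. 0)"
  by (simp add: boundary_def fun_eq_iff)

lemma zero_cycle: "(\<lambda>\<sigma>. 0) \<in> cycles X k"
  by (simp add: cycles_def chain_group_def)

lemma cycles_add: "c \<in> cycles X k \<Longrightarrow> d \<in> cycles X k \<Longrightarrow> (\<lambda>\<sigma>. c \<sigma> + d \<sigma>) \<in> cycles X k"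
  using boundary_add[of c X k d] by (simp add: cycles_def chain_add)

lemma boundaries_subset_reduced_cycles:
  "abstract_complex X \<Longrightarrow> boundaries X k \<subseteq> reduced_cycles X k"
  unfolding boundaries_def reduced_cycles_def cycles_def
  by (auto simp: boundary_chain boundary_boundary augmentation_boundary)

lemma boundaries_add:
  assumes "c \<in> boundaries X k" "d \<in> boundaries X k"
  shows "(\<lambda>\<sigma>. c \<sigma> + d \<sigma>) \<in> boundaries X k"
proof -
  obtain c' d' where *: "c' \<in> carrier (chain_group X (Suc k))" "c = boundary c'"
    "d' \<in> carrier (chain_group X (Suc k))" "d = boundary d'"
    using assms by (auto simp: boundaries_def)
  then have "(\<lambda>\<sigma>. c \<sigma> + d \<sigma>) = boundary (\<lambda>\<sigma>. c' \<sigma> + d' \<sigma>)"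
    using boundary_add[OF *(1,3)] by simp
  then show ?thesis
    using chain_add[OF *(1,3)] unfolding boundaries_def by blast
qed

lemma zero_boundary: "(\<lambda>\<sigma>. 0) \<in> boundaries X k"
  unfolding boundaries_def
  by (rule image_eqI[of _ _ "\<lambda>\<sigma>. 0"]) (simp_all add: chain_group_def)

lemma chain_group_mono: "X \<subseteq> Y \<Longrightarrow> carrier (chain_group X k) \<subseteq> carrier (chain_group Y k)"
  by (auto simp: chain_group_def)

lemma cycles_mono: "X \<subseteq> Y \<Longrightarrow> cycles X k \<subseteq> cycles Y k"
  using chain_group_mono[of X Y k] by (auto simp: cycles_def)

lemma boundaries_mono: "X \<subseteq> Y \<Longrightarrow> boundaries X k \<subseteq> boundaries Y k"
  unfolding boundaries_def by (intro image_mono chain_group_mono)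

lemma add_self_chain: "(\<lambda>\<sigma>. c \<sigma> + (c \<sigma> + d \<sigma>)) = (d :: 'v set \<Rightarrow> bit)"
  by (simp add: fun_eq_iff bit_add_self flip: add.assoc)

definition cycle_group :: "'v set set \<Rightarrow> nat \<Rightarrow> ('v set \<Rightarrow> bit) monoid" where
  "cycle_group X k = (chain_group X k)\<lparr>carrier := cycles X k\<rparr>"

lemma cycle_group_simps [simp]:
  "carrier (cycle_group X k) = cycles X k"
  "c \<otimes>\<^bsub>cycle_group X k\<^esub> d = (\<lambda>\<sigma>. c \<sigma> + d \<sigma>)"
  "\<one>\<^bsub>cycle_group X k\<^esub> = (\<lambda>\<sigma>. 0)"
  by (simp_all add: cycle_group_def chain_group_def)

lemma group_cycle_group: "group (cycle_group X k)"
proof (rule groupI)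
  show "\<exists>d\<in>carrier (cycle_group X k). d \<otimes>\<^bsub>cycle_group X k\<^esub> c = \<one>\<^bsub>cycle_group X k\<^esub>"
    if "c \<in> carrier (cycle_group X k)" for c
    using that by (intro bexI[of _ c]) (simp_all add: bit_add_self)
qed (auto simp: zero_cycle cycles_add add.assoc)

lemma homology_eq: "homology X k = cycle_group X k Mod boundaries X k"
  by (simp add: homology_def cycle_group_def)

section \<open>Classes of cycles and the maps induced by inclusions\<close>

abbreviation coset :: "'v set set \<Rightarrow> nat \<Rightarrow> ('v set \<Rightarrow> bit) \<Rightarrow> ('v set \<Rightarrow> bit) set" where
  "coset X k z \<equiv> (\<lambda>b \<sigma>. b \<sigma> + z \<sigma>) ` boundaries X k"

lemma carrier_homology: "carrier (homology X k) = coset X k ` cycles X k"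
  by (auto simp: homology_eq FactGroup_def RCOSETS_def r_coset_def)

lemma carrier_reduced_homology: "carrier (reduced_homology X k) = coset X k ` reduced_cycles X k"
  by (auto simp: reduced_homology_def FactGroup_def RCOSETS_def r_coset_def chain_group_def)

text \<open>Adding all boundaries of \<open>Y\<close> absorbs those of \<open>X\<close>, while the
  representative \<open>z\<close> stays the same. Later arguments can therefore be made with
  cycles.\<close>

lemma inclusion_map_coset:
  assumes "X \<subseteq> Y"
  shows "inclusion_map Y k (coset X k z) = coset Y k z"
proof -
  have "inclusion_map Y k (coset X k z) =
      {(\<lambda>\<sigma>. (a \<sigma> + z \<sigma>) + b \<sigma>) | a b. a \<in> boundaries X k \<and> b \<in> boundaries Y k}"
    unfolding inclusion_map_def set_mult_def by (auto simp: chain_group_def)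
  also have "\<dots> = coset Y k z"
  proof (intro equalityI subsetI)
    fix y assume "y \<in> {(\<lambda>\<sigma>. (a \<sigma> + z \<sigma>) + b \<sigma>) | a b. a \<in> boundaries X k \<and> b \<in> boundaries Y k}"
    then obtain a b where ab: "y = (\<lambda>\<sigma>. (a \<sigma> + z \<sigma>) + b \<sigma>)" "a \<in> boundaries Y k" "b \<in> boundaries Y k"
      using boundaries_mono[OF assms] by blast
    show "y \<in> coset Y k z"
      using boundaries_add[OF ab(2,3)]
      by (rule image_eqI[rotated]) (simp add: ab(1) fun_eq_iff ac_simps)
  next
    fix y assume "y \<in> coset Y k z"
    then obtain b where "b \<in> boundaries Y k" "y = (\<lambda>\<sigma>. ((0 + z \<sigma>) + b \<sigma>))"
      by (auto simp: add.commute)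
    then show "y \<in> {(\<lambda>\<sigma>. (a \<sigma> + z \<sigma>) + b \<sigma>) | a b. a \<in> boundaries X k \<and> b \<in> boundaries Y k}"
      using zero_boundary[of X k]
      by - (rule CollectI, rule exI[of _ "\<lambda>\<sigma>. 0"], rule exI[of _ b], blast)
  qed
  finally show ?thesis .
qed

lemma coset_boundary:
  assumes "z \<in> boundaries X k"
  shows "coset X k z = boundaries X k"
proof (intro equalityI subsetI)
  fix y assume y: "y \<in> boundaries X k"
  show "y \<in> coset X k z"
    using boundaries_add[OF assms y]
    by (rule image_eqI[rotated]) (simp add: fun_eq_iff ac_simps add_self_chain[THEN fun_cong])
qed (use boundaries_add[OF _ assms] in auto)

lemma inclusion_map_reduced_homology_trivial:
  assumes "X \<subseteq> Y" and "A \<in> carrier (reduced_homology X k)"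
    and "\<And>z. z \<in> reduced_cycles X k \<Longrightarrow> z \<in> boundaries Y k"
  shows "inclusion_map Y k A = \<one>\<^bsub>reduced_homology Y k\<^esub>"
proof -
  obtain z where "z \<in> reduced_cycles X k" "A = coset X k z"
    using assms(2) unfolding carrier_reduced_homology by blast
  then have "inclusion_map Y k A = boundaries Y k"
    using inclusion_map_coset[OF assms(1), of k z] coset_boundary[OF assms(3)] by simp
  then show ?thesis
    by (simp add: reduced_homology_def FactGroup_def)
qed

lemma inclusion_map_homology_carrier:
  assumes "X \<subseteq> Y" "A \<in> carrier (homology X k)"
  shows "inclusion_map Y k A \<in> carrier (homology Y k)"
proof -
  obtain z where "z \<in> cycles X k" "A = coset X k z"
    using assms(2) unfolding carrier_homology by blast
  then show ?thesis
    unfolding carrier_homology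
    using cycles_mono[OF assms(1)] inclusion_map_coset[OF assms(1)] by blast
qed

text \<open>The isomorphism theorem at each parameter: coordinates \<open>h\<close> on cycles that
  are onto and have the boundaries as kernel induce coordinates on homology. Naturality can be
  checked on cycles because the induced map keeps the representative.\<close>

lemma decomposes_homologyI:
  fixes F :: "real \<Rightarrow> 'v set set" and m :: "real set \<Rightarrow> nat"
    and h :: "real \<Rightarrow> ('v set \<Rightarrow> bit) \<Rightarrow> real set \<times> nat \<Rightarrow> int"
  defines "J \<equiv> {(S, i). i < m S}"
  defines "G \<equiv> (\<lambda>\<alpha>. sum_group J (\<lambda>(S, i). interval_space S \<alpha>))"
  assumes F: "\<And>\<alpha> \<beta>. 0 \<le> \<alpha> \<Longrightarrow> \<alpha> \<le> \<beta> \<Longrightarrow> F \<alpha> \<subseteq> F \<beta>"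
    and m: "\<And>S. m S > 0 \<Longrightarrow> S \<noteq> {} \<and> is_interval S \<and> S \<subseteq> {0..}"
    and hom: "\<And>\<alpha>. 0 \<le> \<alpha> \<Longrightarrow> h \<alpha> \<in> hom (cycle_group (F \<alpha>) K) (G \<alpha>)"
    and surj: "\<And>\<alpha>. 0 \<le> \<alpha> \<Longrightarrow> h \<alpha> ` cycles (F \<alpha>) K = carrier (G \<alpha>)"
    and ker: "\<And>\<alpha>. 0 \<le> \<alpha> \<Longrightarrow> {z \<in> cycles (F \<alpha>) K. h \<alpha> z = \<one>\<^bsub>G \<alpha>\<^esub>} = boundaries (F \<alpha>) K"
    and nat: "\<And>\<alpha> \<beta> z. 0 \<le> \<alpha> \<Longrightarrow> \<alpha> \<le> \<beta> \<Longrightarrow> z \<in> cycles (F \<alpha>) K \<Longrightarrow>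
       h \<beta> z = (\<lambda>(S, i)\<in>J. interval_map S \<alpha> \<beta> (h \<alpha> z (S, i)))"
  shows "decomposes (\<lambda>\<alpha>. homology (F \<alpha>) K) (\<lambda>\<alpha> \<beta>. inclusion_map (F \<beta>) K) m"
proof -
  have "group ((\<lambda>(S, i). interval_space S \<alpha>) j)" for \<alpha> and j :: "real set \<times> nat"
    by (simp add: group_interval_space split: prod.split)
  then have G: "group (G \<alpha>)" for \<alpha>
    unfolding G_def by (rule sum_group)
  have gh: "group_hom (cycle_group (F \<alpha>) K) (G \<alpha>) (h \<alpha>)" if "0 \<le> \<alpha>" for \<alpha>
    using G group_cycle_group hom[OF that] by (simp add: group_hom_def group_hom_axioms_def)
  \<comment> \<open>\<open>h \<alpha>\<close> is constant on each class, so the image of a class is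
    a singleton.\<close>
  define \<phi> where "\<phi> \<alpha> A = the_elem (h \<alpha> ` A)" for \<alpha> A
  have iso: "\<phi> \<alpha> \<in> iso (homology (F \<alpha>) K) (G \<alpha>)" if "0 \<le> \<alpha>" for \<alpha>
  proof -
    have "kernel (cycle_group (F \<alpha>) K) (G \<alpha>) (h \<alpha>) = boundaries (F \<alpha>) K"
      using ker[OF that] by (simp add: kernel_def)
    then show ?thesis
      using group_hom.FactGroup_iso_set[OF gh[OF that]] surj[OF that]
      unfolding homology_eq \<phi>_def by simp
  qed
  have \<phi>_coset: "\<phi> \<alpha> (coset (F \<alpha>) K z) = h \<alpha> z" if "0 \<le> \<alpha>" "z \<in> cycles (F \<alpha>) K" for \<alpha> z
  proof -
    interpret group_hom "cycle_group (F \<alpha>) K" "G \<alpha>" "h \<alpha>"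
      using gh that by blast
    have "h \<alpha> (\<lambda>\<sigma>. b \<sigma> + z \<sigma>) = h \<alpha> z" if b: "b \<in> boundaries (F \<alpha>) K" for b
    proof -
      have "b \<in> cycles (F \<alpha>) K" "h \<alpha> b = \<one>\<^bsub>G \<alpha>\<^esub>"
        using b ker[OF \<open>0 \<le> \<alpha>\<close>] by blast+
      then show ?thesis
        using hom_mult[of b z] hom_closed[of z] \<open>z \<in> cycles (F \<alpha>) K\<close> by simp
    qed
    then have "h \<alpha> ` coset (F \<alpha>) K z = {h \<alpha> z}"
      using zero_boundary[of "F \<alpha>" K] by (simp add: image_image image_constant_conv cong: image_cong) blast
    then show ?thesis by (simp add: \<phi>_def)
  qed
  have "\<phi> \<beta> (inclusion_map (F \<beta>) K A) = (\<lambda>(S, i)\<in>J. interval_map S \<alpha> \<beta> (\<phi> \<alpha> A (S, i)))"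
    if le: "0 \<le> \<alpha>" "\<alpha> \<le> \<beta>" and A: "A \<in> carrier (homology (F \<alpha>) K)" for \<alpha> \<beta> A
  proof -
    obtain z where z: "z \<in> cycles (F \<alpha>) K" "A = coset (F \<alpha>) K z"
      using A by (auto simp: carrier_homology)
    have "z \<in> cycles (F \<beta>) K"
      using z cycles_mono[OF F[OF le]] by blast
    then have "\<phi> \<beta> (inclusion_map (F \<beta>) K A) = h \<beta> z"
      using \<phi>_coset le z inclusion_map_coset[OF F[OF le]] by simp
    then show ?thesis
      using nat[OF le z(1)] \<phi>_coset[OF le(1) z(1)] by (simp only: z(2))
  qed
  then show ?thesis
    unfolding decomposes_def Let_def using m iso unfolding J_def G_def by blast
qed

section \<open>Filtrations passing through the boundary of a simplex\<close>

abbreviation simplex_boundary :: "nat \<Rightarrow> nat set set" where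
  "simplex_boundary N \<equiv> {\<sigma>. \<sigma> \<noteq> {} \<and> \<sigma> \<subset> {..N}}"

text \<open>A chain of dimension \<open>K + 1\<close> would need a simplex with \<open>K + 2\<close>
  vertices, which is all of them, and the full simplex is missing.\<close>

lemma boundaries_simplex_boundary: "boundaries (simplex_boundary (Suc K)) K = {\<lambda>\<sigma>. 0}"
proof -
  have "c = (\<lambda>\<sigma>. 0)" if c: "c \<in> carrier (chain_group (simplex_boundary (Suc K)) (Suc K))" for c
  proof (rule ext, rule ccontr)
    fix \<sigma> assume "c \<sigma> \<noteq> 0"
    then have "\<sigma> \<subset> {..Suc K}" "card \<sigma> = Suc (Suc K)"
      using chain_carrierD(2,3)[OF c, of \<sigma>] by auto
    then show False
      using psubset_card_mono[of "{..Suc K}" \<sigma>] by simp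
  qed
  then have "boundaries (simplex_boundary (Suc K)) K \<subseteq> {boundary (\<lambda>\<sigma>. 0)}"
    unfolding boundaries_def by blast
  then show ?thesis
    using zero_boundary[of "simplex_boundary (Suc K)" K] by auto
qed

text \<open>The cone over \<open>c\<close> with apex \<open>Suc K\<close> only sees the coefficient at the facet opposite to the apex.\<close>

lemma reduced_cycle_simplex_boundary_eq_0:
  assumes c: "c \<in> reduced_cycles (simplex_boundary (Suc K)) K" and 0: "c {..K} = 0"
  shows "c = (\<lambda>\<sigma>. 0)"
proof -
  have c': "c \<in> carrier (chain_group (simplex_boundary (Suc K)) K)"
    using c by (auto simp: reduced_cycles_def cycles_def)
  have "(if Suc K \<in> \<tau> then c (\<tau> - {Suc K}) else 0) = 0" for \<tau>
  proof (rule ccontr)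
    assume "\<not> ?thesis"
    then have *: "c (\<tau> - {Suc K}) \<noteq> 0" by (auto split: if_splits)
    then have "\<tau> - {Suc K} \<subseteq> {..K}" "card (\<tau> - {Suc K}) = Suc K"
      using chain_carrierD(2,3)[OF c', of "\<tau> - {Suc K}"] by (auto simp: le_Suc_eq)
    then have "\<tau> - {Suc K} = {..K}"
      by (simp add: card_subset_eq)
    then show False using * 0 by simp
  qed
  then show ?thesis
    using boundary_cone[OF c, of "Suc K"] by simp
qed

text \<open>The witness is the boundary of the single top simplex. Being a boundary makes it a
  reduced cycle, and it lives on the proper faces because its simplices have only
  \<open>K + 1\<close> vertices.\<close>

lemma fundamental_cycle:
  obtains w where "w \<in> reduced_cycles (simplex_boundary (Suc K)) K" "w {..K} = 1"
proof
  let ?D = "{\<sigma>. \<sigma> \<noteq> {} \<and> \<sigma> \<subseteq> {..Suc K}}"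
  let ?c = "\<lambda>\<sigma>. if \<sigma> = {..Suc K} then 1 else 0 :: bit"
  have D: "abstract_complex ?D"
    by (auto simp: abstract_complex_def intro: finite_subset)
  have c: "?c \<in> carrier (chain_group ?D (Suc K))"
    by (auto simp: chain_group_def)
  have w: "boundary ?c \<in> reduced_cycles ?D K"
    using boundaries_subset_reduced_cycles[OF D, of K] c unfolding boundaries_def by blast
  then have w': "boundary ?c \<in> carrier (chain_group ?D K)"
    by (auto simp: reduced_cycles_def cycles_def)
  have "\<sigma> \<in> simplex_boundary (Suc K)" if "boundary ?c \<sigma> \<noteq> 0" for \<sigma>
    using chain_carrierD(2,3)[OF w' that] by auto
  then have "boundary ?c \<in> carrier (chain_group (simplex_boundary (Suc K)) K)"
    using w' by (simp add: chain_group_def)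
  then show "boundary ?c \<in> reduced_cycles (simplex_boundary (Suc K)) K"
    using w by (simp add: reduced_cycles_def cycles_def)
  have "{\<sigma>. ?c \<sigma> \<noteq> 0 \<and> {..K} \<subseteq> \<sigma> \<and> card \<sigma> = Suc (card {..K})} = {{..Suc K}}"
    by auto
  then show "boundary ?c {..K} = 1"
    unfolding boundary_def by simp
qed

text \<open>A predicate, because the simplifier would substitute an equation \<open>K = 0\<close> into the parameters of
  the locale constants below, after which their equations no longer match.\<close>

definition degree0 :: "nat \<Rightarrow> bool" where
  "degree0 K \<longleftrightarrow> K = 0"

lemma mult_interval_space:
  "x \<otimes>\<^bsub>interval_space S \<alpha>\<^esub> y = (if \<alpha> \<in> S then (x + y) mod 2 else 0)"
  by (simp add: interval_space_def singleton_group_def)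

lemma of_bit_add: "(of_bit (x + y) :: int) = (of_bit x + of_bit y) mod 2"
  by (cases x; cases y) auto

text \<open>The nerve and the union both fit this description, with different \<open>d\<close>. The
  sphere present from \<open>b\<close> to \<open>d\<close> carries the finite bar, and
  \<open>{0}\<close> represents the component that never dies. In degree 0 the sphere is a pair of
  points that is there from the start, hence \<open>b = 0\<close>.\<close>

locale boundary_filtration =
  fixes F :: "real \<Rightarrow> nat set set" and K :: nat and b d :: real
  assumes filtration: "simplicial_filtration F"
    and bd: "0 \<le> b" "b < d" "K = 0 \<Longrightarrow> b = 0"
    and inside: "\<And>\<alpha>. b \<le> \<alpha> \<Longrightarrow> \<alpha> < d \<Longrightarrow> F \<alpha> = simplex_boundary (Suc K)"
    and outside: "\<And>\<alpha>. 0 \<le> \<alpha> \<Longrightarrow> \<not> (b \<le> \<alpha> \<and> \<alpha> < d) \<Longrightarrow> reduced_cycles (F \<alpha>) K \<subseteq> boundaries (F \<alpha>) K"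
    and vertex: "\<And>\<alpha>. 0 \<le> \<alpha> \<Longrightarrow> {0} \<in> F \<alpha>"
begin

lemma mono: "0 \<le> \<alpha> \<Longrightarrow> \<alpha> \<le> \<beta> \<Longrightarrow> F \<alpha> \<subseteq> F \<beta>"
  using filtration by (simp add: simplicial_filtration_def)

lemma complex: "0 \<le> \<alpha> \<Longrightarrow> abstract_complex (F \<alpha>)"
  using filtration by (simp add: simplicial_filtration_def)

definition J :: "(real set \<times> nat) set" where
  "J = {(S, i). i < single_bar (degree0 K) b d S}"

lemma J_eq: "J = insert ({b..<d}, 0) (if degree0 K then {({0..}, 0)} else {})"
  by (auto simp: J_def less_single_bar_iff)

lemma J_cases:
  assumes "j \<in> J"
  obtains "j = ({b..<d}, 0)" | "degree0 K" "j = ({0..}, 0)"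
  using assms by (auto simp: J_eq split: if_splits)

text \<open>While \<open>F \<alpha>\<close> is the boundary of the simplex, a reduced cycle is determined by its coefficient at
  the single facet \<open>{..K}\<close>.\<close>

definition class_coords :: "real \<Rightarrow> (nat set \<Rightarrow> bit) \<Rightarrow> real set \<times> nat \<Rightarrow> int" where
  "class_coords \<alpha> z = (\<lambda>(S, i)\<in>J. if \<alpha> \<notin> S then 0
     else if S = {b..<d} then of_bit (z {..K}) else of_bit (augmentation z))"

lemma class_coords_bar:
  "class_coords \<alpha> z ({b..<d}, 0) = (if b \<le> \<alpha> \<and> \<alpha> < d then of_bit (z {..K}) else 0)"
  by (simp add: class_coords_def J_eq)

lemma class_coords_component:
  "degree0 K \<Longrightarrow> 0 \<le> \<alpha> \<Longrightarrow> class_coords \<alpha> z ({0..}, 0) = of_bit (augmentation z)"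
  using ico_neq_ici[of b d, symmetric] unfolding class_coords_def J_eq by simp

lemma class_coords_extensional: "class_coords \<alpha> z \<in> extensional J"
  by (simp add: class_coords_def)

lemma class_coords_eqI:
  assumes "y \<in> extensional J" "0 \<le> \<alpha>"
    and "y ({b..<d}, 0) = (if b \<le> \<alpha> \<and> \<alpha> < d then of_bit (z {..K}) else 0)"
    and "degree0 K \<Longrightarrow> y ({0..}, 0) = of_bit (augmentation z)"
  shows "class_coords \<alpha> z = y"
proof (rule extensionalityI[OF class_coords_extensional assms(1)])
  fix j assume "j \<in> J"
  then show "class_coords \<alpha> z j = y j"
    using assms(2-) by (cases rule: J_cases) (simp_all add: class_coords_bar class_coords_component)
qed

abbreviation G :: "real \<Rightarrow> (real set \<times> nat \<Rightarrow> int) monoid" where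
  "G \<alpha> \<equiv> sum_group J (\<lambda>(S, i). interval_space S \<alpha>)"

lemma carrier_G:
  assumes "0 \<le> \<alpha>"
  shows "y \<in> carrier (G \<alpha>) \<longleftrightarrow> y \<in> extensional J \<and>
    y ({b..<d}, 0) \<in> (if b \<le> \<alpha> \<and> \<alpha> < d then {0, 1} else {0}) \<and> (degree0 K \<longrightarrow> y ({0..}, 0) \<in> {0, 1})"
proof -
  have "finite J" by (simp add: J_eq)
  then show ?thesis
    using assms unfolding carrier_sum_interval_space by (auto simp: J_eq)
qed

lemma class_coords_carrier: "0 \<le> \<alpha> \<Longrightarrow> class_coords \<alpha> z \<in> carrier (G \<alpha>)"
  using carrier_G class_coords_extensional class_coords_bar class_coords_component
  by (cases "z {..K}"; cases "augmentation z") simp_all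

lemma augmentation_add_cycles:
  "degree0 K \<Longrightarrow> z \<in> cycles (F \<alpha>) K \<Longrightarrow> w \<in> cycles (F \<alpha>) K \<Longrightarrow>
    augmentation (\<lambda>\<sigma>. z \<sigma> + w \<sigma>) = augmentation z + augmentation w"
  using augmentation_add[of z "F \<alpha>" w] by (simp add: cycles_def degree0_def)

lemma class_coords_hom:
  assumes "0 \<le> \<alpha>"
  shows "class_coords \<alpha> \<in> hom (cycle_group (F \<alpha>) K) (G \<alpha>)"
proof (rule homI)
  fix z w assume zw: "z \<in> carrier (cycle_group (F \<alpha>) K)" "w \<in> carrier (cycle_group (F \<alpha>) K)"
  have "class_coords \<alpha> (\<lambda>\<sigma>. z \<sigma> + w \<sigma>) = class_coords \<alpha> z \<otimes>\<^bsub>G \<alpha>\<^esub> class_coords \<alpha> w"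
  proof (rule class_coords_eqI[OF _ assms])
    show "class_coords \<alpha> z \<otimes>\<^bsub>G \<alpha>\<^esub> class_coords \<alpha> w \<in> extensional J"
      by simp
    show "(class_coords \<alpha> z \<otimes>\<^bsub>G \<alpha>\<^esub> class_coords \<alpha> w) ({b..<d}, 0) =
        (if b \<le> \<alpha> \<and> \<alpha> < d then of_bit (z {..K} + w {..K}) else 0)"
      by (simp add: J_eq mult_interval_space class_coords_bar of_bit_add del: even_add odd_add)
    show "(class_coords \<alpha> z \<otimes>\<^bsub>G \<alpha>\<^esub> class_coords \<alpha> w) ({0..}, 0) = of_bit (augmentation (\<lambda>\<sigma>. z \<sigma> + w \<sigma>))"
      if "degree0 K"
      using that assms augmentation_add_cycles[OF that, of z \<alpha> w] zw
        class_coords_component[OF that assms, of z] class_coords_component[OF that assms, of w]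
      by (simp add: J_eq mult_interval_space of_bit_add del: even_add odd_add)
  qed
  then show "class_coords \<alpha> (z \<otimes>\<^bsub>cycle_group (F \<alpha>) K\<^esub> w) = class_coords \<alpha> z \<otimes>\<^bsub>G \<alpha>\<^esub> class_coords \<alpha> w"
    by simp
qed (use class_coords_carrier assms in simp)

lemma class_coords_eq_one_iff:
  assumes "0 \<le> \<alpha>"
  shows "class_coords \<alpha> z = \<one>\<^bsub>G \<alpha>\<^esub> \<longleftrightarrow>
    (b \<le> \<alpha> \<and> \<alpha> < d \<longrightarrow> z {..K} = 0) \<and> (degree0 K \<longrightarrow> augmentation z = 0)"
proof -
  have one: "\<one>\<^bsub>G \<alpha>\<^esub> = (\<lambda>j\<in>J. 0)"
    by (simp add: one_interval_space case_prod_beta)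
  show ?thesis
  proof
    assume eq: "class_coords \<alpha> z = \<one>\<^bsub>G \<alpha>\<^esub>"
    have "class_coords \<alpha> z ({b..<d}, 0) = 0" "degree0 K \<Longrightarrow> class_coords \<alpha> z ({0..}, 0) = 0"
      unfolding eq one by (simp_all add: J_eq)
    then show "(b \<le> \<alpha> \<and> \<alpha> < d \<longrightarrow> z {..K} = 0) \<and> (degree0 K \<longrightarrow> augmentation z = 0)"
      using assms by (auto simp: class_coords_bar class_coords_component split: if_splits)
  next
    assume "(b \<le> \<alpha> \<and> \<alpha> < d \<longrightarrow> z {..K} = 0) \<and> (degree0 K \<longrightarrow> augmentation z = 0)"
    then show "class_coords \<alpha> z = \<one>\<^bsub>G \<alpha>\<^esub>"
      unfolding one by (intro class_coords_eqI assms) (auto simp: J_eq)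
  qed
qed

lemma boundaries_inside: "b \<le> \<alpha> \<Longrightarrow> \<alpha> < d \<Longrightarrow> boundaries (F \<alpha>) K = {\<lambda>\<sigma>. 0}"
  using inside boundaries_simplex_boundary by simp

text \<open>In degree 0 the augmentation coordinate makes a cycle in the kernel reduced; in higher
  degrees every cycle is. While the sphere is present the other coordinate then forces the cycle to
  be zero, and at other times every reduced cycle bounds.\<close>

lemma class_coords_kernel:
  assumes "0 \<le> \<alpha>"
  shows "{z \<in> cycles (F \<alpha>) K. class_coords \<alpha> z = \<one>\<^bsub>G \<alpha>\<^esub>} = boundaries (F \<alpha>) K"
proof (intro equalityI subsetI)
  fix z assume "z \<in> {z \<in> cycles (F \<alpha>) K. class_coords \<alpha> z = \<one>\<^bsub>G \<alpha>\<^esub>}"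
  then have z: "z \<in> reduced_cycles (F \<alpha>) K" "b \<le> \<alpha> \<and> \<alpha> < d \<Longrightarrow> z {..K} = 0"
    using class_coords_eq_one_iff[OF assms, of z] by (auto simp: reduced_cycles_def degree0_def)
  show "z \<in> boundaries (F \<alpha>) K"
  proof (cases "b \<le> \<alpha> \<and> \<alpha> < d")
    case True
    then have "z = (\<lambda>\<sigma>. 0)"
      using z inside by (intro reduced_cycle_simplex_boundary_eq_0) auto
    then show ?thesis by (simp add: zero_boundary)
  next
    case False
    then show ?thesis using z outside assms by blast
  qed
next
  fix z assume z: "z \<in> boundaries (F \<alpha>) K"
  then have "z \<in> reduced_cycles (F \<alpha>) K"
    using boundaries_subset_reduced_cycles complex assms by blast
  moreover have "z {..K} = 0" if "b \<le> \<alpha> \<and> \<alpha> < d"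
    using z boundaries_inside that by simp
  ultimately show "z \<in> {z \<in> cycles (F \<alpha>) K. class_coords \<alpha> z = \<one>\<^bsub>G \<alpha>\<^esub>}"
    using class_coords_eq_one_iff[OF assms, of z] by (simp add: reduced_cycles_def degree0_def)
qed

lemma vertex_cycle:
  assumes "degree0 K" "0 \<le> \<alpha>"
  shows "(\<lambda>\<sigma>. if \<sigma> = {0} then 1 else 0) \<in> cycles (F \<alpha>) K" (is "?v \<in> _")
    and "augmentation (\<lambda>\<sigma>. if \<sigma> = {0 :: nat} then 1 else 0) = 1"
proof -
  have v: "?v \<in> carrier (chain_group (F \<alpha>) 0)"
    using vertex[OF assms(2)] by (auto simp: chain_group_def)
  have "boundary ?v \<tau> = 0" for \<tau>
    using boundary_eq_0[OF v, of \<tau>] by (cases "infinite \<tau> \<or> card \<tau> \<noteq> 0") auto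
  then show "?v \<in> cycles (F \<alpha>) K"
    using v assms by (simp add: cycles_def fun_eq_iff degree0_def)
  show "augmentation (\<lambda>\<sigma>. if \<sigma> = {0 :: nat} then 1 else 0) = 1"
    by (simp add: augmentation_def)
qed

lemma class_coords_surj:
  assumes "0 \<le> \<alpha>"
  shows "class_coords \<alpha> ` cycles (F \<alpha>) K = carrier (G \<alpha>)"
proof -
  interpret group_hom "cycle_group (F \<alpha>) K" "G \<alpha>" "class_coords \<alpha>"
  proof -
    have "group ((\<lambda>(S, i). interval_space S \<alpha>) j)" for j :: "real set \<times> nat"
      by (simp add: group_interval_space split: prod.split)
    then show "group_hom (cycle_group (F \<alpha>) K) (G \<alpha>) (class_coords \<alpha>)"
      using group_cycle_group class_coords_hom[OF assms] sum_group
      by (simp add: group_hom_def group_hom_axioms_def)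
  qed
  \<comment> \<open>The two coordinates can be prescribed independently: the vertex
    \<open>{0}\<close> sets the augmentation, and adding the fundamental cycle, whose augmentation
    is 0 in degree 0, corrects the coefficient at \<open>{..K}\<close>.\<close>
  have lift: "\<exists>z\<in>cycles (F \<alpha>) K. (b \<le> \<alpha> \<and> \<alpha> < d \<longrightarrow> z {..K} = s) \<and> (degree0 K \<longrightarrow> augmentation z = t)" for s t
  proof -
    have "\<exists>z\<in>cycles (F \<alpha>) K. degree0 K \<longrightarrow> augmentation z = t"
    proof (cases "degree0 K \<and> t = 1")
      case True
      then show ?thesis using vertex_cycle[OF _ assms] by blast
    next
      case False
      then show ?thesis
        by (intro bexI[OF _ zero_cycle]) (auto simp: augmentation_def)
    qed
    then obtain z where z: "z \<in> cycles (F \<alpha>) K" "degree0 K \<longrightarrow> augmentation z = t" by blast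
    show ?thesis
    proof (cases "b \<le> \<alpha> \<and> \<alpha> < d \<and> z {..K} \<noteq> s")
      case True
      obtain w where w: "w \<in> reduced_cycles (F \<alpha>) K" "w {..K} = 1"
        using fundamental_cycle inside True by metis
      then have wc: "w \<in> cycles (F \<alpha>) K" and aug: "degree0 K \<longrightarrow> augmentation w = 0"
        by (auto simp: reduced_cycles_def degree0_def)
      have "z {..K} + w {..K} = s"
        using True w by (cases s; cases "z {..K}") auto
      moreover have "degree0 K \<longrightarrow> augmentation (\<lambda>\<sigma>. z \<sigma> + w \<sigma>) = t"
        using augmentation_add_cycles[OF _ z(1) wc] aug z(2) by simp
      ultimately show ?thesis
        using cycles_add[OF z(1) wc] by (intro bexI) auto
    qed (use z in blast)
  qed
  show ?thesis
  proof (intro equalityI subsetI)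
    fix y assume y: "y \<in> carrier (G \<alpha>)"
    define s t :: bit where "s = of_bool (y ({b..<d}, 0) = 1)" and "t = of_bool (y ({0..}, 0) = 1)"
    obtain z where z: "z \<in> cycles (F \<alpha>) K" "b \<le> \<alpha> \<and> \<alpha> < d \<longrightarrow> z {..K} = s" "degree0 K \<longrightarrow> augmentation z = t"
      using lift by blast
    have "class_coords \<alpha> z = y"
      using y z(2,3) unfolding carrier_G[OF assms]
      by (intro class_coords_eqI assms) (auto simp: s_def t_def split: if_splits)
    then show "y \<in> class_coords \<alpha> ` cycles (F \<alpha>) K"
      using z(1) by blast
  qed (use class_coords_carrier assms in blast)
qed

lemma class_coords_natural:
  assumes le: "0 \<le> \<alpha>" "\<alpha> \<le> \<beta>" and z: "z \<in> cycles (F \<alpha>) K"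
  shows "class_coords \<beta> z = (\<lambda>(S, i)\<in>J. interval_map S \<alpha> \<beta> (class_coords \<alpha> z (S, i)))"
proof (rule class_coords_eqI)
  show "0 \<le> \<beta>" using le by simp
  \<comment> \<open>The critical case of naturality: before the bar begins its coordinate is 0, so
    it must still be 0 at \<beta>. The cycle bounds at \<alpha>, hence also in the sphere at
    \<beta>, where only 0 is a boundary.\<close>
  have "z {..K} = 0" if "\<alpha> < b" "b \<le> \<beta>" "\<beta> < d"
  proof -
    have "\<not> degree0 K" using that le bd by (auto simp: degree0_def)
    then have "z \<in> boundaries (F \<alpha>) K"
      using outside[of \<alpha>] that le z by (auto simp: reduced_cycles_def degree0_def)
    then have "z \<in> boundaries (F \<beta>) K"
      using boundaries_mono[OF mono[OF le]] by blast
    then show ?thesis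
      using boundaries_inside[of \<beta>] that by simp
  qed
  then show "(\<lambda>(S, i)\<in>J. interval_map S \<alpha> \<beta> (class_coords \<alpha> z (S, i))) ({b..<d}, 0) =
      (if b \<le> \<beta> \<and> \<beta> < d then of_bit (z {..K}) else 0)"
    using le by (auto simp: J_eq interval_map_def class_coords_bar)
  show "(\<lambda>(S, i)\<in>J. interval_map S \<alpha> \<beta> (class_coords \<alpha> z (S, i))) ({0..}, 0) = of_bit (augmentation z)"
    if "degree0 K"
    using that le class_coords_component[OF that le(1), of z]
    by (simp add: J_eq interval_map_def)
qed simp

lemma barcode_eq:
  "barcode (\<lambda>\<alpha>. homology (F \<alpha>) K) (\<lambda>\<alpha> \<beta>. inclusion_map (F \<beta>) K) = single_bar (degree0 K) b d"
proof (rule barcode_eq_single_bar)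
  show "decomposes (\<lambda>\<alpha>. homology (F \<alpha>) K) (\<lambda>\<alpha> \<beta>. inclusion_map (F \<beta>) K) (single_bar (degree0 K) b d)"
  proof (rule decomposes_homologyI[where h = class_coords])
    show "S \<noteq> {} \<and> is_interval S \<and> S \<subseteq> {0..}" if "single_bar (degree0 K) b d S > 0" for S
      using that bd unfolding less_single_bar_iff by (auto simp: is_interval_1)
  qed (rule mono class_coords_hom[unfolded J_def] class_coords_surj[unfolded J_def]
      class_coords_kernel[unfolded J_def] class_coords_natural[unfolded J_def]; assumption)+
  show "inclusion_map (F \<beta>) K x \<in> carrier (homology (F \<beta>) K)"
    if "0 \<le> \<alpha>" "\<alpha> \<le> \<beta>" "x \<in> carrier (homology (F \<alpha>) K)" for \<alpha> \<beta> x
    using inclusion_map_homology_carrier mono that by blast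
qed (use bd in \<open>auto simp: degree0_def\<close>)

end

section \<open>Bottleneck distance of two diagrams with one moving point\<close>

lemma birth_death_ico:
  assumes "b < d"
  shows "birth {b..<d} = ereal b" "death {b..<d} = ereal d"
proof -
  show "birth {b..<d} = ereal b"
    unfolding birth_def using assms by (intro antisym Inf_lower Inf_greatest) auto
  show "death {b..<d} = ereal d"
    unfolding death_def
  proof (rule Sup_eqI)
    fix y assume y: "\<And>z. z \<in> ereal ` {b..<d} \<Longrightarrow> z \<le> y"
    show "ereal d \<le> y"
    proof (rule dense_le_bounded[of "ereal b"])
      fix w assume "ereal b < w" "w < ereal d"
      then obtain t where "w = ereal t" "b < t" "t < d" by (cases w) auto
      then show "w \<le> y" using y[of w] by simp
    qed (use assms in simp)
  qed auto
qed

lemma birth_death_ici: "birth {0..} = 0" "death {0..} = \<infinity>"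
proof -
  have "ereal 0 \<in> ereal ` {0..}" by (rule imageI) simp
  then show "birth {0..} = 0"
    unfolding birth_def zero_ereal_def by (intro antisym Inf_lower Inf_greatest) auto
  have "ereal t \<le> death {0..}" for t
  proof -
    have "ereal (max t 0) \<le> death {0..}"
      unfolding death_def by (intro Sup_upper imageI) simp
    then show ?thesis
      by (rule order_trans[rotated]) simp
  qed
  then show "death {0..} = \<infinity>"
    using ereal_infty_less_eq(1) ereal_top by blast
qed

lemma diagram_single_bar:
  assumes "b < d"
  shows "diagram_of_barcode (single_bar e b d) (x, y) =
    (if x = y then (if \<bar>x\<bar> \<noteq> \<infinity> then \<infinity> else 0)
     else enat (of_bool (x = ereal b \<and> y = ereal d) + of_bool (e \<and> x = 0 \<and> y = \<infinity>)))"
proof -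
  have "{(S, i). i < single_bar e b d S \<and> birth S = x \<and> death S = y} =
      (if x = ereal b \<and> y = ereal d then {({b..<d}, 0)} else {}) \<union>
      (if e \<and> x = 0 \<and> y = \<infinity> then {({0..}, 0)} else {})" (is "?L = ?R")
  proof (rule Set.set_eqI)
    fix p :: "real set \<times> nat"
    obtain S i where p: "p = (S, i)" by force
    have "(S, i) \<in> ?L \<longleftrightarrow> i = 0 \<and> (S = {b..<d} \<or> e \<and> S = {0..}) \<and> birth S = x \<and> death S = y"
      by (simp only: less_single_bar_iff mem_Collect_eq prod.case conj_assoc)
    also have "\<dots> \<longleftrightarrow> i = 0 \<and> (S = {b..<d} \<and> x = ereal b \<and> y = ereal d \<or> e \<and> S = {0..} \<and> x = 0 \<and> y = \<infinity>)"
      using birth_death_ico[OF assms] birth_death_ici by metis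
    also have "\<dots> \<longleftrightarrow> (S, i) \<in> ?R"
      by (simp add: conj_commute split: if_split)
    finally show "p \<in> ?L \<longleftrightarrow> p \<in> ?R"
      unfolding p .
  qed
  then show ?thesis
    unfolding diagram_of_barcode_def by simp
qed

lemma coord_dist_ereal: "coord_dist (ereal x) (ereal y) = ereal \<bar>x - y\<bar>"
  by (simp add: coord_dist_def)

text \<open>The matching for the upper bound: it moves the one point in which the diagrams differ
  and fixes every copy of every other point, on the diagonal too.\<close>

lemma points_swap_bij:
  assumes "D p = 1" "D' p = 0" "D q = 0" "D' q = 1"
    and "\<And>r. r \<noteq> p \<Longrightarrow> r \<noteq> q \<Longrightarrow> D r = D' r"
  shows "bij_betw (\<lambda>(r, i). (if r = p then q else r, i)) (points D) (points D')"
proof (rule bij_betw_byWitness[where f' = "\<lambda>(r, i). (if r = q then p else r, i)"])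
  have pq: "p \<noteq> q" using assms by auto
  have in_D: "(r, i) \<in> points D \<longleftrightarrow> (if r = p then i = 0 else r \<noteq> q \<and> enat i < D' r)" for r i
    using assms pq by (cases "r = p"; cases "r = q") (auto simp: points_def one_enat_def zero_enat_def)
  have in_D': "(r, i) \<in> points D' \<longleftrightarrow> (if r = q then i = 0 else r \<noteq> p \<and> enat i < D' r)" for r i
    using assms pq by (cases "r = p"; cases "r = q") (auto simp: points_def one_enat_def zero_enat_def)
  show "\<forall>x\<in>points D. (\<lambda>(r, i). (if r = q then p else r, i)) ((\<lambda>(r, i). (if r = p then q else r, i)) x) = x"
    by (auto simp: in_D split: if_splits)
  show "\<forall>x\<in>points D'. (\<lambda>(r, i). (if r = p then q else r, i)) ((\<lambda>(r, i). (if r = q then p else r, i)) x) = x"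
    by (auto simp: in_D' split: if_splits)
  show "(\<lambda>(r, i). (if r = p then q else r, i)) ` points D \<subseteq> points D'"
    by (auto simp: in_D in_D' split: if_splits)
  show "(\<lambda>(r, i). (if r = q then p else r, i)) ` points D' \<subseteq> points D"
    using pq by (auto simp: in_D in_D' split: if_splits)
qed

text \<open>For the lower bound it is enough to look at the partner of \<open>(b, d')\<close>. A
  point \<open>(u, u)\<close> is at distance at least half of \<open>d' - b\<close>, which by
  \<open>half\<close> is at least \<open>d' - d\<close>; the point \<open>(b, d)\<close> is at
  exactly this distance, and a point with infinite death is infinitely far.\<close>

lemma bottleneck_dist_single_bar:
  assumes b: "0 \<le> b" "b < d" "d < d'" and half: "2 * (d' - d) \<le> d' - b"
  shows "bottleneck_dist (diagram_of_barcode (single_bar e b d)) (diagram_of_barcode (single_bar e b d'))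
    = ereal (d' - d)"
proof -
  let ?D = "diagram_of_barcode (single_bar e b d)" and ?D' = "diagram_of_barcode (single_bar e b d')"
  let ?p = "(ereal b, ereal d)" and ?q = "(ereal b, ereal d')"
  let ?\<phi> = "\<lambda>(r :: ereal \<times> ereal, i :: nat). (if r = ?p then ?q else r, i)"
  have bd': "b < d'" using b by simp
  note D = diagram_single_bar[OF b(2)] and D' = diagram_single_bar[OF bd']
  have Dp: "?D ?p = 1" "?D' ?p = 0" "?D ?q = 0" "?D' ?q = 1"
    using b by (simp_all add: D D' one_enat_def zero_enat_def)
  have "?D r = ?D' r" if "r \<noteq> ?p" "r \<noteq> ?q" for r
    using that by (cases r) (auto simp: D D')
  note bij = points_swap_bij[of ?D ?p ?D' ?q, OF Dp this]
  show ?thesis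
  proof (rule antisym)
    have "linf_dist (fst x) (fst (?\<phi> x)) \<le> ereal (d' - d)" for x :: "(ereal \<times> ereal) \<times> nat"
      using b by (auto simp: linf_dist_def coord_dist_ereal split_beta) (auto simp: coord_dist_def)
    then have "(SUP x\<in>points ?D. linf_dist (fst x) (fst (?\<phi> x))) \<le> ereal (d' - d)"
      by (intro SUP_least)
    then show "bottleneck_dist ?D ?D' \<le> ereal (d' - d)"
      unfolding bottleneck_dist_def using bij by (intro INF_lower2[of ?\<phi>] CollectI)
  next
    have "ereal (d' - d) \<le> (SUP x\<in>points ?D. linf_dist (fst x) (fst (\<phi> x)))"
      if \<phi>: "bij_betw \<phi> (points ?D) (points ?D')" for \<phi>
    proof -
      have "(?q, 0) \<in> points ?D'"
        using Dp by (simp add: points_def zero_enat_def one_enat_def)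
      then obtain x where x: "x \<in> points ?D" "\<phi> x = (?q, 0)"
        using \<phi> by (metis bij_betw_imp_surj_on imageE)
      obtain s t i where st: "x = ((s, t), i)" by (metis surj_pair)
      have "?D (s, t) \<noteq> 0"
        using x(1) by (auto simp: st points_def)
      then consider u where "s = ereal u" "t = ereal u" | "s = ereal b" "t = ereal d" | "t = \<infinity>"
        unfolding D by (cases s) (auto simp: zero_enat_def split: if_splits)
      then have "ereal (d' - d) \<le> linf_dist (s, t) ?q"
      proof cases
        case (1 u)
        then show ?thesis
          using b half by (auto simp: linf_dist_def coord_dist_ereal le_max_iff_disj)
      next
        case 2
        then show ?thesis
          using b by (auto simp: linf_dist_def coord_dist_ereal)
      next
        case 3
        then show ?thesis
          by (simp add: linf_dist_def coord_dist_def le_max_iff_disj)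
      qed
      then show ?thesis
        using x by (intro SUP_upper2[OF x(1)]) (simp add: st)
    qed
    then show "ereal (d' - d) \<le> bottleneck_dist ?D ?D'"
      unfolding bottleneck_dist_def by (intro INF_greatest) simp
  qed
qed

section \<open>The cover\<close>

text \<open>Vertex \<open>q\<close> appears at time \<open>q (q - 1)\<close>, so that stage \<open>r\<close>, the time when the vertices are \<open>0, \<dots>, r\<close>, is
  \<open>r (r - 1) \<le> a < r (r + 1)\<close>. Before stage \<open>i\<close> the piece \<open>i\<close> is empty. At stage \<open>i\<close> it is the facet
  opposite to \<open>0\<close>, and from \<open>a = i\<^sup>2\<close> on also the skeleton of dimension \<open>a - i\<^sup>2\<close> of the whole simplex.
  From stage \<open>i + 1\<close> on it is the facet opposite to \<open>i + 1\<close>.\<close>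

definition cover_piece :: "nat \<Rightarrow> nat \<Rightarrow> nat set set" where
  "cover_piece i a = {\<sigma>. \<sigma> \<noteq> {} \<and>
     (if i * Suc i \<le> a then \<sigma> \<subseteq> {q. q * (q - 1) \<le> a} - {Suc i}
      else i * (i - 1) \<le> a \<and> \<sigma> \<subseteq> {..i} \<and> (0 \<notin> \<sigma> \<or> card \<sigma> + i * i \<le> Suc a))}"

section \<open>Stages, and the pieces and their intersections at a given stage\<close>

definition stage :: "nat \<Rightarrow> nat \<Rightarrow> bool" where
  "stage r a \<longleftrightarrow> 0 < r \<and> r * (r - 1) \<le> a \<and> a < r * Suc r"

lemma stage_exists: obtains r where "stage r a"
proof -
  have "a < Suc a * Suc (Suc a)" by simp
  then have ex: "\<exists>r. a < r * Suc r" by blast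
  define r where "r = (LEAST r. a < r * Suc r)"
  have r: "a < r * Suc r"
    unfolding r_def using LeastI_ex[OF ex] .
  then have "r \<noteq> 0" by (cases r) auto
  then obtain q where q: "r = Suc q" using not0_implies_Suc by blast
  then have "\<not> a < q * Suc q"
    using not_less_Least[of q "\<lambda>r. a < r * Suc r"] r_def by simp
  then have "stage r a"
    using r q by (simp add: stage_def mult.commute)
  then show ?thesis by (rule that)
qed

lemma pronic_mono: "p \<le> q \<Longrightarrow> p * (p - 1) \<le> q * (q - 1 :: nat)"
  by (intro mult_mono) auto

lemma stage_vertices:
  assumes "stage r a"
  shows "{q. q * (q - 1) \<le> a} = {..r}"
proof (intro equalityI subsetI)
  fix q assume "q \<in> {q. q * (q - 1) \<le> a}"
  then have "\<not> Suc r \<le> q"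
    using pronic_mono[of "Suc r" q] assms by (auto simp: stage_def mult.commute)
  then show "q \<in> {..r}" by simp
next
  fix q assume "q \<in> {..r}"
  then show "q \<in> {q. q * (q - 1) \<le> a}"
    using pronic_mono[of q r] assms by (simp add: stage_def)
qed

lemma cover_piece_old:
  assumes "stage r a" "i < r"
  shows "cover_piece i a = {\<sigma>. \<sigma> \<noteq> {} \<and> \<sigma> \<subseteq> {..r} - {Suc i}}"
proof -
  have "i * Suc i \<le> a"
    using pronic_mono[of "Suc i" r] assms by (simp add: stage_def mult.commute)
  then show ?thesis
    using stage_vertices[OF assms(1)] by (simp add: cover_piece_def)
qed

lemma cover_piece_current:
  assumes "stage r a"
  shows "cover_piece r a = {\<sigma>. \<sigma> \<noteq> {} \<and> \<sigma> \<subseteq> {..r} \<and> (0 \<notin> \<sigma> \<or> card \<sigma> + r * r \<le> Suc a)}"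
  using assms by (simp add: cover_piece_def stage_def)

lemma cover_piece_future:
  assumes "stage r a" "r < i"
  shows "cover_piece i a = {}"
proof -
  have "r * Suc r \<le> i * (i - 1)"
    using pronic_mono[of "Suc r" i] assms(2) by (simp add: mult.commute)
  moreover have "i * (i - 1) \<le> i * Suc i" by (intro mult_le_mono) auto
  ultimately show ?thesis
    using assms by (simp add: cover_piece_def stage_def)
qed

text \<open>The change of form at time \<open>i * Suc i\<close> loses nothing: before it the piece
  is a subcomplex of the simplex on \<open>{..i}\<close>, and no face of that contains the vertex
  \<open>Suc i\<close> that is left out from then on.\<close>

lemma cover_piece_mono:
  assumes "a \<le> b"
  shows "cover_piece i a \<subseteq> cover_piece i b"
proof
  fix \<sigma> assume \<sigma>: "\<sigma> \<in> cover_piece i a"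
  show "\<sigma> \<in> cover_piece i b"
  proof (cases "i * Suc i \<le> a")
    case True
    then have "i * Suc i \<le> b" "\<sigma> \<noteq> {}" "\<sigma> \<subseteq> {q. q * (q - 1) \<le> a} - {Suc i}"
      using \<sigma> assms by (simp_all add: cover_piece_def)
    moreover have "{q. q * (q - 1) \<le> a} \<subseteq> {q. q * (q - 1) \<le> b}"
      using assms by (auto intro: order_trans)
    ultimately show ?thesis
      unfolding cover_piece_def by auto
  next
    case False
    then have *: "i * (i - 1) \<le> a" "\<sigma> \<noteq> {}" "\<sigma> \<subseteq> {..i}" "0 \<notin> \<sigma> \<or> card \<sigma> + i * i \<le> Suc a"
      using \<sigma> by (simp_all add: cover_piece_def)
    have "q * (q - 1) \<le> b" if "q \<in> \<sigma>" for q
      using pronic_mono[of q i] *(1,3) that assms by (meson atMost_iff order_trans subsetD)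
    then show ?thesis
      using * assms unfolding cover_piece_def by auto
  qed
qed

lemma cover_piece_subset:
  assumes "stage r a"
  shows "cover_piece i a \<subseteq> Pow {..r}"
proof -
  consider "i < r" | "i = r" | "r < i" by linarith
  then show ?thesis
    by cases (use assms cover_piece_old cover_piece_current cover_piece_future in auto)
qed

lemma finite_cover_piece: "finite (cover_piece i a)"
  by (rule stage_exists[of a], rule finite_subset[OF cover_piece_subset]) auto

lemma cover_piece_face:
  assumes "\<sigma> \<in> cover_piece i a" "\<tau> \<subseteq> \<sigma>" "\<tau> \<noteq> {}"
  shows "\<tau> \<in> cover_piece i a"
proof -
  obtain r where r: "stage r a" by (rule stage_exists)
  have "finite \<sigma>"
    using cover_piece_subset[OF r] assms(1) finite_subset by blast
  then have "card \<tau> \<le> card \<sigma>"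
    using assms(2) by (rule card_mono)
  then show ?thesis
    using assms unfolding cover_piece_def by (auto split: if_splits)
qed

lemma abstract_complex_cover_piece: "abstract_complex (cover_piece i a)"
proof -
  obtain r where r: "stage r a" by (rule stage_exists)
  have "finite \<sigma> \<and> \<sigma> \<noteq> {}" if "\<sigma> \<in> cover_piece i a" for \<sigma>
  proof
    show "finite \<sigma>"
      using cover_piece_subset[OF r] that finite_subset[of \<sigma> "{..r}"] by blast
    show "\<sigma> \<noteq> {}"
      using that by (simp add: cover_piece_def)
  qed
  then show ?thesis
    using cover_piece_face by (auto simp: abstract_complex_def)
qed

text \<open>Each older piece \<open>i\<close> in \<open>v\<close> just deletes the vertex
  \<open>Suc i\<close>, so the intersection is a full simplex on the remaining vertices, cut down by
  the skeleton condition if the current piece \<open>r\<close> takes part.\<close>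

lemma cover_piece_inter_iff:
  assumes r: "stage r a" and v: "v \<noteq> {}"
  shows "\<sigma> \<in> (\<Inter>i\<in>v. cover_piece i a) \<longleftrightarrow>
    \<sigma> \<noteq> {} \<and> v \<subseteq> {..r} \<and> \<sigma> \<subseteq> {..r} - Suc ` (v - {r}) \<and> (r \<in> v \<longrightarrow> 0 \<notin> \<sigma> \<or> card \<sigma> + r * r \<le> Suc a)"
    (is "_ \<longleftrightarrow> ?R")
proof -
  have piece: "\<sigma> \<in> cover_piece i a \<longleftrightarrow> \<sigma> \<noteq> {} \<and> i \<le> r \<and> \<sigma> \<subseteq> {..r} \<and> (i \<noteq> r \<longrightarrow> Suc i \<notin> \<sigma>) \<and>
      (i = r \<longrightarrow> 0 \<notin> \<sigma> \<or> card \<sigma> + r * r \<le> Suc a)" for i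
  proof -
    consider "i < r" | "i = r" | "r < i" by linarith
    then show ?thesis
      by cases (use r cover_piece_old cover_piece_current cover_piece_future in auto)
  qed
  show ?thesis
    unfolding INT_iff piece using v by blast
qed

text \<open>Taking all pieces \<open>{..r}\<close> deletes every vertex except \<open>0\<close>, and
  \<open>{0}\<close> enters piece \<open>r\<close> at time \<open>r * r\<close>. A smaller
  \<open>v\<close> leaves \<open>0\<close> unrestricted if it omits \<open>r\<close>, and otherwise
  keeps some vertex \<open>Suc j\<close> with \<open>j \<notin> v\<close>.\<close>

lemma cover_piece_inter_nonempty_iff:
  assumes r: "stage r a" and v: "v \<noteq> {}"
  shows "(\<Inter>i\<in>v. cover_piece i a) \<noteq> {} \<longleftrightarrow> v \<subseteq> {..r} \<and> (v = {..r} \<longrightarrow> r * r \<le> a)"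
proof
  assume "(\<Inter>i\<in>v. cover_piece i a) \<noteq> {}"
  then obtain \<sigma> where "\<sigma> \<in> (\<Inter>i\<in>v. cover_piece i a)" by blast
  then have \<sigma>: "\<sigma> \<noteq> {}" "v \<subseteq> {..r}" "\<sigma> \<subseteq> {..r} - Suc ` (v - {r})" "r \<in> v \<longrightarrow> 0 \<notin> \<sigma> \<or> card \<sigma> + r * r \<le> Suc a"
    unfolding cover_piece_inter_iff[OF assms] by blast+
  have "r * r \<le> a" if "v = {..r}"
  proof -
    have "q = 0" if "q \<in> \<sigma>" for q
    proof (cases q)
      case (Suc j)
      then have "j \<in> v - {r}" using \<open>v = {..r}\<close> \<sigma>(3) that by auto
      then show ?thesis using \<sigma>(3) that Suc by blast
    qed
    then have "\<sigma> = {0}" using \<sigma>(1) by blast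
    then show ?thesis using \<sigma>(4) that by simp
  qed
  then show "v \<subseteq> {..r} \<and> (v = {..r} \<longrightarrow> r * r \<le> a)" using \<sigma>(2) by blast
next
  assume v': "v \<subseteq> {..r} \<and> (v = {..r} \<longrightarrow> r * r \<le> a)"
  show "(\<Inter>i\<in>v. cover_piece i a) \<noteq> {}"
  proof (cases "r \<in> v \<and> v \<noteq> {..r}")
    case True
    then obtain j where "j \<le> r" "j \<notin> v" using v' by auto
    moreover from this have "j \<noteq> r" using True by blast
    ultimately have "{Suc j} \<in> (\<Inter>i\<in>v. cover_piece i a)"
      unfolding cover_piece_inter_iff[OF assms] using v' by auto
    then show ?thesis by blast
  next
    case False
    then have "{0} \<in> (\<Inter>i\<in>v. cover_piece i a)"
      unfolding cover_piece_inter_iff[OF assms] using v' by auto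
    then show ?thesis by blast
  qed
qed

lemma cover_piece_inter_mono: "a \<le> b \<Longrightarrow> (\<Inter>i\<in>v. cover_piece i a) \<subseteq> (\<Inter>i\<in>v. cover_piece i b)"
  using cover_piece_mono by blast

lemma cover_piece_inter_cone:
  assumes v: "v \<noteq> {}" and ne: "(\<Inter>i\<in>v. cover_piece i a) \<noteq> {}"
  shows "\<exists>p. \<forall>\<sigma>\<in>(\<Inter>i\<in>v. cover_piece i a). card \<sigma> = Suc k \<longrightarrow>
    insert p \<sigma> \<in> (\<Inter>i\<in>v. cover_piece i (Suc a))"
proof -
  obtain r where r: "stage r a" by (rule stage_exists)
  note iff = cover_piece_inter_iff[OF r v]
  have vr: "v \<subseteq> {..r}" using ne cover_piece_inter_nonempty_iff[OF r v] by blast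
  note mono = subsetD[OF cover_piece_inter_mono[of a "Suc a" v, OF le_SucI[OF order_refl]]]
  \<comment> \<open>If \<open>r \<in> v\<close>, the apex \<open>0\<close> works up to the dimension of the skeleton present; a simplex of
    larger dimension lies in the facet opposite to \<open>0\<close>, whose intersection with the other pieces is a
    full simplex.\<close>
  consider "r \<notin> v" | "r \<in> v" "k + r * r \<le> a" | "r \<in> v" "a < k + r * r" by linarith
  then show ?thesis
  proof cases
    case 1
    have step: "insert 0 \<sigma> \<in> (\<Inter>i\<in>v. cover_piece i a)" if "\<sigma> \<in> (\<Inter>i\<in>v. cover_piece i a)" for \<sigma>
      using that 1 unfolding iff by auto
    show ?thesis
      by (intro exI[of _ 0] ballI impI mono step)
  next
    case 2
    have step: "insert 0 \<sigma> \<in> (\<Inter>i\<in>v. cover_piece i (Suc a))"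
      if "\<sigma> \<in> (\<Inter>i\<in>v. cover_piece i a)" and card: "card \<sigma> = Suc k" for \<sigma>
    proof -
      have \<sigma>: "\<sigma> \<noteq> {}" "\<sigma> \<subseteq> {..r} - Suc ` (v - {r})"
        using that(1) unfolding iff by blast+
      show ?thesis
      proof (cases "Suc a < r * Suc r")
        case True
        then have r': "stage r (Suc a)" using r by (simp add: stage_def)
        \<comment> \<open>In one step the bound on the number of vertices of simplices through
          \<open>0\<close> grows by one, which pays for the added vertex \<open>0\<close>.\<close>
        have "card (insert 0 \<sigma>) \<le> Suc (Suc k)"
          using card card_insert_le_m1[of "Suc (Suc k)" \<sigma> 0] by simp
        then show ?thesis
          unfolding cover_piece_inter_iff[OF r' v] using \<sigma> vr 2 by auto
      next
        case False
        \<comment> \<open>The stage ends here: piece \<open>r\<close> becomes an older piece that no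
          longer restricts \<open>0\<close>, and the vertex \<open>Suc r\<close> that it avoids is
          new, hence not in \<open>insert 0 \<sigma>\<close>.\<close>
        then have "Suc a = r * Suc r" using r by (simp add: stage_def)
        then have r': "stage (Suc r) (Suc a)" by (simp add: stage_def mult.commute)
        have "Suc r \<notin> v" using vr by auto
        moreover have "insert 0 \<sigma> \<subseteq> {..Suc r} - Suc ` (v - {Suc r})"
          using \<sigma>(2) by (auto simp: le_Suc_eq)
        ultimately show ?thesis
          unfolding cover_piece_inter_iff[OF r' v] using vr by auto
      qed
    qed
    show ?thesis
      by (intro exI[of _ 0] ballI impI step)
  next
    case 3
    have no0: "0 \<notin> \<sigma>" if "\<sigma> \<in> (\<Inter>i\<in>v. cover_piece i a)" "card \<sigma> = Suc k" for \<sigma>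
      using that 3 unfolding iff by auto
    show ?thesis
    proof (cases "v = {..r}")
      case True
      \<comment> \<open>With all pieces taking part only the vertex \<open>0\<close> is left, and
        \<open>no0\<close> excludes it, so there are no simplices of this dimension.\<close>
      have "False" if \<sigma>: "\<sigma> \<in> (\<Inter>i\<in>v. cover_piece i a)" "card \<sigma> = Suc k" for \<sigma>
      proof -
        have *: "\<sigma> \<noteq> {}" "\<sigma> \<subseteq> {..r} - Suc ` (v - {r})"
          using \<sigma>(1) unfolding iff by blast+
        then obtain q where q: "q \<in> \<sigma>" by blast
        then obtain j where "q = Suc j"
          using no0[OF \<sigma>] by (cases q) auto
        moreover from this have "j \<in> v - {r}" using True *(2) q by auto
        ultimately show False using *(2) q by blast
      qed
      then show ?thesis by blast
    next
      case False
      then obtain j where j: "j \<le> r" "j \<notin> v" using vr by auto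
      then have "j \<noteq> r" using 3 by blast
      have step: "insert (Suc j) \<sigma> \<in> (\<Inter>i\<in>v. cover_piece i a)"
        if \<sigma>: "\<sigma> \<in> (\<Inter>i\<in>v. cover_piece i a)" "card \<sigma> = Suc k" for \<sigma>
        using \<sigma>(1) no0[OF \<sigma>] j \<open>j \<noteq> r\<close> unfolding iff by auto
      show ?thesis
        by (intro exI[of _ "Suc j"] ballI impI mono step)
    qed
  qed
qed

text \<open>A proper face misses some vertex \<open>q\<close> and so lies in the facet opposite to
  \<open>q\<close>, which belongs to piece \<open>r\<close> for \<open>q = 0\<close> and to piece
  \<open>j\<close> for \<open>q = Suc j\<close>.\<close>

lemma cover_piece_union_stage:
  assumes r: "stage r a" and "r \<le> m"
  shows "(\<Union>i\<le>m. cover_piece i a) = {\<sigma>. \<sigma> \<noteq> {} \<and> \<sigma> \<subset> {..r}}"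
proof (intro equalityI subsetI)
  fix \<sigma> assume "\<sigma> \<in> (\<Union>i\<le>m. cover_piece i a)"
  then obtain i where i: "\<sigma> \<in> cover_piece i a" by blast
  consider "i < r" | "i = r" | "r < i" by linarith
  then show "\<sigma> \<in> {\<sigma>. \<sigma> \<noteq> {} \<and> \<sigma> \<subset> {..r}}"
  proof cases
    case 1
    then have "\<sigma> \<noteq> {}" "\<sigma> \<subseteq> {..r} - {Suc i}" "Suc i \<in> {..r}"
      using i cover_piece_old[OF r 1] by auto
    then show ?thesis by blast
  next
    case 2
    then have *: "\<sigma> \<noteq> {}" "\<sigma> \<subseteq> {..r}" "0 \<notin> \<sigma> \<or> card \<sigma> + r * r \<le> Suc a"
      using i cover_piece_current[OF r] by auto
    \<comment> \<open>The full simplex has \<open>r + 1\<close> vertices and would enter piece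
      \<open>r\<close> at time \<open>r * r + r\<close>, which is exactly the end of the
      stage.\<close>
    have "card {..r} + r * r > Suc a" using r by (simp add: stage_def)
    then have "\<sigma> \<noteq> {..r}" using *(3) by auto
    then show ?thesis using * by blast
  next
    case 3
    then show ?thesis using i cover_piece_future[OF r] by blast
  qed
next
  fix \<sigma> assume "\<sigma> \<in> {\<sigma>. \<sigma> \<noteq> {} \<and> \<sigma> \<subset> {..r}}"
  then obtain q where \<sigma>: "\<sigma> \<noteq> {}" "\<sigma> \<subseteq> {..r}" "q \<le> r" "q \<notin> \<sigma>" by blast
  show "\<sigma> \<in> (\<Union>i\<le>m. cover_piece i a)"
  proof (cases q)
    case 0
    then have "\<sigma> \<in> cover_piece r a" using \<sigma> cover_piece_current[OF r] by simp
    then show ?thesis using assms(2) by blast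
  next
    case (Suc j)
    then have "\<sigma> \<in> cover_piece j a" using \<sigma> cover_piece_old[OF r, of j] by auto
    then show ?thesis using assms(2) \<sigma>(3) Suc by auto
  qed
qed

text \<open>After stage \<open>m\<close> every piece is a full simplex with \<open>0\<close> among
  its vertices.\<close>

lemma cover_piece_union_cone:
  assumes r: "stage r a" and "m < r" and "\<sigma> \<in> (\<Union>i\<le>m. cover_piece i a)"
  shows "insert 0 \<sigma> \<in> (\<Union>i\<le>m. cover_piece i a)"
  using assms cover_piece_old[OF r] by auto

text \<open>Since \<open>K\<close> is not the top dimension \<open>r - 1\<close> of the sphere, a
  simplex of dimension \<open>K\<close> has at most \<open>r - 1\<close> vertices and stays a proper
  face when \<open>0\<close> is added. Hence reduced cycles of degree \<open>K\<close> can be coned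
  off inside the sphere.\<close>

lemma simplex_boundary_acyclic:
  assumes "r \<noteq> Suc K" "\<sigma> \<in> {\<sigma>. \<sigma> \<noteq> {} \<and> \<sigma> \<subset> {..r}}" "card \<sigma> = Suc K"
  shows "insert 0 \<sigma> \<in> {\<sigma>. \<sigma> \<noteq> {} \<and> \<sigma> \<subset> {..r :: nat}}"
proof -
  have "card \<sigma> < card {..r}"
    using assms(2) by (intro psubset_card_mono) auto
  then have "Suc K < r" using assms by simp
  then have "card (insert 0 \<sigma>) < card {..r}"
    using assms(3) card_insert_le_m1[of "Suc (Suc K)" \<sigma> 0] by simp
  then have "insert 0 \<sigma> \<noteq> {..r}" by auto
  then show ?thesis using assms(2) by auto
qed

section \<open>Passage from integer steps to real parameters\<close>

definition cover :: "nat \<Rightarrow> real \<Rightarrow> nat set set" where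
  "cover i \<alpha> = cover_piece i (nat \<lfloor>\<alpha>\<rfloor>)"

lemma nat_floor_less_iff: "0 \<le> \<alpha> \<Longrightarrow> nat \<lfloor>\<alpha>\<rfloor> < N \<longleftrightarrow> \<alpha> < real N"
  by linarith

lemma stage_floor_iff:
  "0 \<le> \<alpha> \<Longrightarrow> 0 < r \<Longrightarrow>
    stage r (nat \<lfloor>\<alpha>\<rfloor>) \<longleftrightarrow> real (r * (r - 1)) \<le> \<alpha> \<and> \<alpha> < real (r * Suc r)"
  unfolding stage_def
  using nat_floor_less_iff[of \<alpha> "r * (r - 1)"] nat_floor_less_iff[of \<alpha> "r * Suc r"] by linarith

lemma cover_piece_vertex: "{0} \<in> cover_piece 0 a"
  by (simp add: cover_piece_def)

lemma cover_inter_cover: "cover_inter cover v \<alpha> = (\<Inter>i\<in>v. cover_piece i (nat \<lfloor>\<alpha>\<rfloor>))"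
  by (simp add: cover_inter_def cover_def)

lemma cover_union_cover: "cover_union m cover \<alpha> = (\<Union>i\<le>m. cover_piece i (nat \<lfloor>\<alpha>\<rfloor>))"
  by (simp add: cover_union_def cover_def)

lemma cover_mono: "\<alpha> \<le> \<beta> \<Longrightarrow> cover i \<alpha> \<subseteq> cover i \<beta>"
  unfolding cover_def by (intro cover_piece_mono nat_mono floor_mono)

lemma simplicial_filtration_cover: "simplicial_filtration (cover i)"
  using cover_mono
  by (simp add: simplicial_filtration_def cover_def abstract_complex_cover_piece finite_cover_piece)

lemma abstract_complex_Union: "(\<And>i. i \<in> I \<Longrightarrow> abstract_complex (A i)) \<Longrightarrow> abstract_complex (\<Union>i\<in>I. A i)"
  unfolding abstract_complex_def by blast

lemma simplicial_filtration_cover_union: "simplicial_filtration (cover_union m cover)"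
  unfolding simplicial_filtration_def
proof (intro conjI allI impI)
  show "abstract_complex (cover_union m cover \<alpha>)" for \<alpha>
    unfolding cover_union_cover by (intro abstract_complex_Union abstract_complex_cover_piece)
  show "finite (cover_union m cover \<alpha>)" for \<alpha>
    unfolding cover_union_cover by (intro finite_UN_I finite_cover_piece) simp
  show "cover_union m cover \<alpha> \<subseteq> cover_union m cover \<beta>" if "0 \<le> \<alpha> \<and> \<alpha> \<le> \<beta>" for \<alpha> \<beta>
    unfolding cover_union_def using that by (intro UN_mono cover_mono) auto
qed

lemma simplicial_filtration_nerve: "simplicial_filtration (nerve m cover)"
proof -
  have "finite (nerve m U \<alpha>)" for U :: "nat \<Rightarrow> real \<Rightarrow> nat set set" and \<alpha>
    by (rule finite_subset[of _ "Pow {..m}"]) (auto simp: nerve_def)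
  moreover have "abstract_complex (nerve m cover \<alpha>)" for \<alpha>
    unfolding abstract_complex_def
  proof (intro ballI conjI allI impI)
    fix \<sigma> assume \<sigma>: "\<sigma> \<in> nerve m cover \<alpha>"
    then show "finite \<sigma>" "\<sigma> \<noteq> {}"
      using finite_subset[of \<sigma> "{..m}"] by (auto simp: nerve_def)
    fix \<tau> assume \<tau>: "\<tau> \<subseteq> \<sigma> \<and> \<tau> \<noteq> {}"
    then have "cover_inter cover \<sigma> \<alpha> \<subseteq> cover_inter cover \<tau> \<alpha>"
      unfolding cover_inter_def by (intro INF_superset_mono) auto
    then show "\<tau> \<in> nerve m cover \<alpha>"
      using \<sigma> \<tau> unfolding nerve_def by auto
  qed
  moreover have "nerve m cover \<alpha> \<subseteq> nerve m cover \<beta>" if "\<alpha> \<le> \<beta>" for \<alpha> \<beta>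
  proof -
    have "cover_inter cover v \<alpha> \<subseteq> cover_inter cover v \<beta>" for v
      unfolding cover_inter_def using cover_mono[OF that] by (intro INF_mono) blast
    then show ?thesis
      unfolding nerve_def by blast
  qed
  ultimately show ?thesis
    by (simp add: simplicial_filtration_def)
qed

text \<open>Rounding down turns the shift by 1 into exactly one discrete step, and over that step
  each reduced cycle of an intersection is coned off by an apex that may depend on its
  dimension.\<close>

lemma good_cover_filtration_cover: "good_cover_filtration 1 m cover (cover_union m cover)"
  unfolding good_cover_filtration_def
proof (intro conjI allI impI ballI refl)
  fix v \<alpha> k A
  assume v: "v \<noteq> {} \<and> v \<subseteq> {..m} \<and> 0 \<le> \<alpha> \<and> cover_inter cover v \<alpha> \<noteq> {}"
    and A: "A \<in> carrier (reduced_homology (cover_inter cover v \<alpha>) k)"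
  have floor: "nat \<lfloor>\<alpha> + 1\<rfloor> = Suc (nat \<lfloor>\<alpha>\<rfloor>)"
    using v by linarith
  show "inclusion_map (cover_inter cover v (\<alpha> + 1)) k A = \<one>\<^bsub>reduced_homology (cover_inter cover v (\<alpha> + 1)) k\<^esub>"
  proof (rule inclusion_map_reduced_homology_trivial[OF _ A])
    show "cover_inter cover v \<alpha> \<subseteq> cover_inter cover v (\<alpha> + 1)"
      unfolding cover_inter_cover floor by (intro cover_piece_inter_mono) simp
    fix z assume z: "z \<in> reduced_cycles (cover_inter cover v \<alpha>) k"
    have "v \<noteq> {}" "(\<Inter>i\<in>v. cover_piece i (nat \<lfloor>\<alpha>\<rfloor>)) \<noteq> {}"
      using v by (simp_all add: cover_inter_cover)
    then obtain p where p: "\<forall>\<sigma>\<in>(\<Inter>i\<in>v. cover_piece i (nat \<lfloor>\<alpha>\<rfloor>)). card \<sigma> = Suc k \<longrightarrow>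
        insert p \<sigma> \<in> (\<Inter>i\<in>v. cover_piece i (Suc (nat \<lfloor>\<alpha>\<rfloor>)))"
      by (rule exE[OF cover_piece_inter_cone])
    show "z \<in> boundaries (cover_inter cover v (\<alpha> + 1)) k"
      unfolding cover_inter_cover floor
      by (rule cone_in_boundaries[OF z[unfolded cover_inter_cover]]) (rule p[rule_format])
  qed
qed

section \<open>Nerve and union as filtrations passing through spheres\<close>

lemma nerve_cover:
  assumes r: "stage r (nat \<lfloor>\<alpha>\<rfloor>)"
  shows "nerve m cover \<alpha> = {v. v \<noteq> {} \<and> v \<subseteq> {..m} \<and> v \<subseteq> {..r} \<and> (v = {..r} \<longrightarrow> r * r \<le> nat \<lfloor>\<alpha>\<rfloor>)}"
  unfolding nerve_def cover_inter_cover
  using cover_piece_inter_nonempty_iff[OF r] by blast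

lemma proper_faces_eq:
  "A \<subseteq> B \<Longrightarrow> {v. v \<noteq> {} \<and> v \<subseteq> B \<and> v \<subseteq> A \<and> v \<noteq> A} = {v. v \<noteq> {} \<and> v \<subset> A}"
  by (intro Collect_cong) auto

lemma boundary_filtration_nerve:
  assumes K: "K < m"
  shows "boundary_filtration (nerve m cover) K (real (Suc K * K)) (real (Suc K * Suc K))"
proof
  show "simplicial_filtration (nerve m cover)" by (rule simplicial_filtration_nerve)
  show "real (Suc K * K) < real (Suc K * Suc K)" by (simp only: of_nat_less_iff) simp
  fix \<alpha> :: real
  show "nerve m cover \<alpha> = simplex_boundary (Suc K)"
    if \<alpha>: "real (Suc K * K) \<le> \<alpha>" "\<alpha> < real (Suc K * Suc K)"
  proof -
    have "0 \<le> \<alpha>" using \<alpha>(1) of_nat_0_le_iff order_trans by blast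
    moreover have "real (Suc K * Suc K) \<le> real (Suc K * Suc (Suc K))"
      by (simp only: of_nat_le_iff) simp
    ultimately have r: "stage (Suc K) (nat \<lfloor>\<alpha>\<rfloor>)"
      using stage_floor_iff[of \<alpha> "Suc K"] \<alpha> by simp
    have "\<not> Suc K * Suc K \<le> nat \<lfloor>\<alpha>\<rfloor>"
      using nat_floor_less_iff[OF \<open>0 \<le> \<alpha>\<close>] \<alpha>(2) by (simp only: not_le)
    then have "nerve m cover \<alpha> = {v. v \<noteq> {} \<and> v \<subseteq> {..m} \<and> v \<subseteq> {..Suc K} \<and> v \<noteq> {..Suc K}}"
      unfolding nerve_cover[OF r] by simp
    also have "\<dots> = simplex_boundary (Suc K)"
      using K by (intro proper_faces_eq) simp
    finally show ?thesis .
  qed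
  assume \<alpha>: "0 \<le> \<alpha>"
  obtain r where r: "stage r (nat \<lfloor>\<alpha>\<rfloor>)" by (rule stage_exists)
  have "cover_inter cover {0} \<alpha> \<noteq> {}"
    using cover_piece_vertex by (auto simp: cover_inter_cover)
  then show "{0} \<in> nerve m cover \<alpha>"
    by (simp add: nerve_def)
  assume out: "\<not> (real (Suc K * K) \<le> \<alpha> \<and> \<alpha> < real (Suc K * Suc K))"
  have cone: "insert 0 \<sigma> \<in> nerve m cover \<alpha>" if \<sigma>: "\<sigma> \<in> nerve m cover \<alpha>" "card \<sigma> = Suc K" for \<sigma>
  \<comment> \<open>Before time \<open>r * r\<close> of a stage \<open>r \<le> m\<close> the nerve
    is a sphere of dimension \<open>r - 1\<close>, which differs from \<open>K\<close> because
    \<alpha> lies outside the bar. Otherwise the nerve is a full simplex and \<open>0\<close> is an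
    apex.\<close>
  proof (cases "r \<le> m \<and> \<not> r * r \<le> nat \<lfloor>\<alpha>\<rfloor>")
    case True
    have "r \<noteq> Suc K"
    proof
      assume "r = Suc K"
      then have "real (Suc K * K) \<le> \<alpha>"
        using r \<alpha> stage_floor_iff[of \<alpha> "Suc K"] by simp
      moreover have "\<alpha> < real (Suc K * Suc K)"
        using True nat_floor_less_iff[OF \<alpha>] \<open>r = Suc K\<close> by (simp only: not_le)
      ultimately show False using out by blast
    qed
    have eq: "nerve m cover \<alpha> = {\<sigma>. \<sigma> \<noteq> {} \<and> \<sigma> \<subset> {..r}}"
    proof -
      have "nerve m cover \<alpha> = {v. v \<noteq> {} \<and> v \<subseteq> {..m} \<and> v \<subseteq> {..r} \<and> v \<noteq> {..r}}"
        unfolding nerve_cover[OF r] using True by simp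
      also have "\<dots> = {\<sigma>. \<sigma> \<noteq> {} \<and> \<sigma> \<subset> {..r}}"
        using True by (intro proper_faces_eq) simp
      finally show ?thesis .
    qed
    show ?thesis
      using \<sigma> unfolding eq by (rule simplex_boundary_acyclic[OF \<open>r \<noteq> Suc K\<close>])
  next
    case False
    \<comment> \<open>For \<open>r > m\<close> the exceptional set \<open>{..r}\<close> is no subset
      of \<open>{..m}\<close>, so the condition on it is void.\<close>
    have "{..r} \<subseteq> insert 0 \<sigma> \<Longrightarrow> r * r \<le> nat \<lfloor>\<alpha>\<rfloor>"
    proof -
      assume sub: "{..r} \<subseteq> insert 0 \<sigma>"
      have "\<sigma> \<subseteq> {..m}" using \<sigma>(1) by (simp add: nerve_def)
      then have "{..r} \<subseteq> {..m}" using sub by auto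
      then show ?thesis using False by simp
    qed
    then have "insert 0 \<sigma> = {..r} \<longrightarrow> r * r \<le> nat \<lfloor>\<alpha>\<rfloor>"
      by simp
    then show ?thesis
      using \<sigma>(1) unfolding nerve_cover[OF r] by simp
  qed
  show "reduced_cycles (nerve m cover \<alpha>) K \<subseteq> boundaries (nerve m cover \<alpha>) K"
    by (intro subsetI cone_in_boundaries[OF _ cone])
qed auto

lemma boundary_filtration_union:
  assumes K: "K < m"
  shows "boundary_filtration (cover_union m cover) K (real (Suc K * K)) (real (Suc K * Suc (Suc K)))"
proof
  show "simplicial_filtration (cover_union m cover)" by (rule simplicial_filtration_cover_union)
  show "real (Suc K * K) < real (Suc K * Suc (Suc K))" by (simp only: of_nat_less_iff) simp
  fix \<alpha> :: real
  have stage: "stage (Suc K) (nat \<lfloor>\<alpha>\<rfloor>) \<longleftrightarrow> real (Suc K * K) \<le> \<alpha> \<and> \<alpha> < real (Suc K * Suc (Suc K))"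
    if "0 \<le> \<alpha>"
    using stage_floor_iff[OF that, of "Suc K"] by simp
  show "cover_union m cover \<alpha> = simplex_boundary (Suc K)"
    if \<alpha>: "real (Suc K * K) \<le> \<alpha>" "\<alpha> < real (Suc K * Suc (Suc K))"
  proof -
    have "0 \<le> \<alpha>" using \<alpha>(1) of_nat_0_le_iff order_trans by blast
    then have r: "stage (Suc K) (nat \<lfloor>\<alpha>\<rfloor>)"
      using stage \<alpha> by blast
    show ?thesis
      unfolding cover_union_cover using K by (intro cover_piece_union_stage[OF r]) simp
  qed
  assume \<alpha>: "0 \<le> \<alpha>"
  obtain r where r: "stage r (nat \<lfloor>\<alpha>\<rfloor>)" by (rule stage_exists)
  show "{0} \<in> cover_union m cover \<alpha>"
    unfolding cover_union_cover using cover_piece_vertex by blast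
  assume out: "\<not> (real (Suc K * K) \<le> \<alpha> \<and> \<alpha> < real (Suc K * Suc (Suc K)))"
  have cone: "insert 0 \<sigma> \<in> cover_union m cover \<alpha>" if \<sigma>: "\<sigma> \<in> cover_union m cover \<alpha>" "card \<sigma> = Suc K" for \<sigma>
  proof (cases "r \<le> m")
    case True
    have "r \<noteq> Suc K"
      using r out stage[OF \<alpha>] by blast
    then show ?thesis
      using \<sigma> unfolding cover_union_cover cover_piece_union_stage[OF r True]
      by (rule simplex_boundary_acyclic)
  next
    case False
    then show ?thesis
      using \<sigma>(1) cover_piece_union_cone[OF r] unfolding cover_union_cover by simp
  qed
  show "reduced_cycles (cover_union m cover \<alpha>) K \<subseteq> boundaries (cover_union m cover \<alpha>) K"
    by (intro subsetI cone_in_boundaries[OF _ cone])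
qed auto

theorem mainTheorem4:
  fixes n :: nat
  shows "\<exists>(m :: nat) (X :: nat set set) (U :: nat \<Rightarrow> real \<Rightarrow> nat set set).
    abstract_complex X \<and>
    (\<forall>i\<le>m. simplicial_filtration (U i) \<and> (\<forall>\<alpha>\<ge>0. U i \<alpha> \<subseteq> X)) \<and>
    good_cover_filtration 1 m U (cover_union m U) \<and>
    (\<forall>K\<le>n. bottleneck_dist (Dgm K (nerve m U)) (Dgm K (cover_union m U)) = ereal (real K + 1))"
proof (intro exI conjI allI impI)
  let ?X = "{\<sigma> :: nat set. finite \<sigma> \<and> \<sigma> \<noteq> {}}"
  show "abstract_complex ?X"
    by (auto simp: abstract_complex_def intro: finite_subset)
  show "simplicial_filtration (cover i)" for i
    by (rule simplicial_filtration_cover)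
  show "cover i \<alpha> \<subseteq> ?X" for i \<alpha>
    using abstract_complex_cover_piece[of i "nat \<lfloor>\<alpha>\<rfloor>"] by (auto simp: abstract_complex_def cover_def)
  \<comment> \<open>Degree \<open>K\<close> is realised at stage \<open>K + 1\<close>, so the
    degrees up to \<open>n\<close> need the pieces up to \<open>n + 1\<close>.\<close>
  show "good_cover_filtration 1 (Suc n) cover (cover_union (Suc n) cover)"
    by (rule good_cover_filtration_cover)
  fix K assume "K \<le> n"
  then have K: "K < Suc n" by simp
  let ?b = "real (Suc K * K)" and ?d = "real (Suc K * Suc K)" and ?d' = "real (Suc K * Suc (Suc K))"
  have diff: "?d' - ?d = real K + 1" "?d' - ?b = 2 * (real K + 1)"
    by (simp_all add: algebra_simps)
  have "?b < ?d" "?d < ?d'"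
    by (simp_all only: of_nat_less_iff) simp_all
  moreover have "0 \<le> ?b" by (rule of_nat_0_le_iff)
  \<comment> \<open>This holds with equality: the diagonal is exactly as far away as the moved
    endpoint.\<close>
  moreover have "2 * (?d' - ?d) \<le> ?d' - ?b" unfolding diff by simp
  ultimately show "bottleneck_dist (Dgm K (nerve (Suc n) cover)) (Dgm K (cover_union (Suc n) cover)) = ereal (real K + 1)"
    unfolding Dgm_def boundary_filtration.barcode_eq[OF boundary_filtration_nerve[OF K]]
      boundary_filtration.barcode_eq[OF boundary_filtration_union[OF K]] diff(1)[symmetric]
    by (intro bottleneck_dist_single_bar)
qed

end
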